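(* Let $\mathcal H$ be a separable complex Hilbert space, let $\Omega\subseteq\mathbb C$ be open and connected, and let $A:\Omega\to\mathcal B(\mathcal H)$ be analytic with $A(z)\in\Phi(\mathcal H)$ for all $z\in\Omega$. Let $z_0\in\Omega$ be a pole of $A(\cdot)^{-1}$. Then $z_0$ is a simple pole of $A(\cdot)^{-1}$ if and only if $$\nu(z_0;A(\cdot))=m_g(0;A(z_0)).$$
   Context: $\mathcal B(\mathcal H)$ denotes the bounded linear operators on $\mathcal H$. $\Phi(\mathcal H)$ is the set of bounded Fredholm operators ($\dim\ker(T)<\infty$, $\operatorname{ran}(T)$ closed, $\dim\ker(T^* )<\infty$). That $z_0$ is a pole of $A(\cdot)^{-1}$ entails that $A(z)$ is boundedly invertible for some $z\in\Omega$, so that by the analytic Fredholm theorem $A(\cdot)^{-1}$ is meromorphic on $\Omega$; the order of the pole refers to the norm convergent Laurent expansion of $A(z)^{-1}$ about $z_0$. The geometric multiplicity is $m_g(0;A(z_0))=\dim(\ker(A(z_0)))$. Definition of $\nu(z_0;A(\cdot))$, for $A(\cdot)$ and $z_0$ as in the claim. For $z$ in a sufficiently small neighborhood $\mathcal N(z_0)\subset\Omega$ of $z_0$, and for suitable small $\varepsilon_0>0$, one introduces the Riesz projection associated with $A(z)$, $P(z)=\frac{-1}{2\pi i}\oint_{|\zeta|=\varepsilon_0}(A(z)-\zeta I_{\mathcal H})^{-1}\,d\zeta$ (counterclockwise), where $P(\cdot)$ is analytic on $\mathcal N(z_0)$ and $\dim(\operatorname{ran}(P(z)))<\infty$, and one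 sets $Q(z)=I_{\mathcal H}-P(z)$. Put $T(z)=P(z_0)P(z)+Q(z_0)Q(z)$; for $\mathcal N(z_0)$ small, $T(\cdot)$ and $T(\cdot)^{-1}$ are analytic on $\mathcal N(z_0)$ and $P(z_0)T(z)=T(z)P(z)$. With respect to $\mathcal H=P(z_0)\mathcal H\dotplus Q(z_0)\mathcal H$ (direct, not necessarily orthogonal) one has the block form $T(z)A(z)T(z)^{-1}=\begin{pmatrix}F(z)&0\\0&G(z)\end{pmatrix}$, with $F,G$ analytic and $G(z)$ boundedly invertible on $\mathcal N(z_0)$. Then $\nu(z_0;A(\cdot))$ is the order of the zero at $z_0$ of the scalar analytic function $z\mapsto\det_{\operatorname{ran}(P(z_0))}(F(z))$ (equal to $0$ if it does not vanish at $z_0$), and $\nu(z_0;A(\cdot))=\infty$ if this function vanishes identically on $\mathcal N(z_0)$.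
   Formalization: The formal theorem assumes that the Riesz projection construction defining ν is possible, in particular that 0 is isolated in the spectrum of A(z0); for some Fredholm families with a pole (e.g. a bilateral shift with one weight z) this fails and ν is undefined. *)

theory Defs
  imports
    "HOL-Complex_Analysis.Complex_Analysis"
    "Jordan_Normal_Form.Determinant"
begin

section \<open>Complex Hilbert spaces\<close>

text \<open>The inner product is linear in the second argument.\<close>

class complex_hilbert = banach +
  fixes scaleC :: "complex \<Rightarrow> 'a \<Rightarrow> 'a" (infixr \<open>*\<^sub>C\<close> 75)
    and cinner :: "'a \<Rightarrow> 'a \<Rightarrow> complex"
  assumes scaleC_add_right: "c *\<^sub>C (x + y) = c *\<^sub>C x + c *\<^sub>C y"
    and scaleC_add_left: "(c + d) *\<^sub>C x = c *\<^sub>C x + d *\<^sub>C x"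
    and scaleC_scaleC: "c *\<^sub>C (d *\<^sub>C x) = (c * d) *\<^sub>C x"
    and scaleR_scaleC: "r *\<^sub>R x = complex_of_real r *\<^sub>C x"
    and cinner_commute: "cinner x y = cnj (cinner y x)"
    and cinner_add_right: "cinner x (y + z) = cinner x y + cinner x z"
    and cinner_scaleC_right: "cinner x (c *\<^sub>C y) = c * cinner x y"
    and cinner_self: "cinner x x = complex_of_real ((norm x)\<^sup>2)"

global_interpretation complex_vector:
  Vector_Spaces.vector_space "scaleC :: complex \<Rightarrow> 'h \<Rightarrow> 'h::complex_hilbert"
proof
  fix x :: 'h
  show "1 *\<^sub>C x = x"
    using scaleR_scaleC[of 1 x] by simp
qed (simp_all add: scaleC_add_right scaleC_add_left scaleC_scaleC)

lemma norm_scaleC: "norm (c *\<^sub>C x) = cmod c * norm (x :: 'h::complex_hilbert)"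
proof -
  have "cinner (c *\<^sub>C x) (c *\<^sub>C x) = c * (cnj c * cinner x x)"
    using cinner_commute[of "c *\<^sub>C x" x] cinner_commute[of x x]
    by (simp add: cinner_scaleC_right)
  also have "\<dots> = complex_of_real ((cmod c)\<^sup>2 * (norm x)\<^sup>2)"
    using complex_norm_square[of c] by (simp add: cinner_self mult.assoc)
  finally have "(norm (c *\<^sub>C x))\<^sup>2 = (cmod c * norm x)\<^sup>2"
    unfolding cinner_self of_real_eq_iff by (simp add: power_mult_distrib)
  then show ?thesis
    by (simp add: power2_eq_iff_nonneg)
qed

lemma bounded_linear_scaleC: "bounded_linear (scaleC c :: 'h \<Rightarrow> 'h::complex_hilbert)"
proof (rule bounded_linear_intro[where K = "cmod c"])
  show "c *\<^sub>C (r *\<^sub>R x) = r *\<^sub>R (c *\<^sub>C x)" for r and x :: 'h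
    by (simp add: scaleR_scaleC scaleC_scaleC mult.commute)
qed (simp_all add: scaleC_add_right norm_scaleC mult.commute)

definition cfinite_dim :: "'h::complex_hilbert set \<Rightarrow> bool" where
  "cfinite_dim V \<longleftrightarrow> (\<exists>B. finite B \<and> V \<subseteq> complex_vector.span B)"

section \<open>Bounded operators\<close>

text \<open>The type \<open>'h \<Rightarrow>\<^sub>L 'h\<close> consists of the bounded real-linear maps; \<open>\<B>(\<H>)\<close>
  is its subset of complex-linear maps.\<close>

definition bounded_ops :: "('h::complex_hilbert \<Rightarrow>\<^sub>L 'h) set" where
  "bounded_ops = {T. \<forall>c x. blinfun_apply T (c *\<^sub>C x) = c *\<^sub>C blinfun_apply T x}"

text \<open>\<open>scalar_op c\<close> is \<open>c I\<close>, and \<open>scalar_op c o\<^sub>L T\<close> is \<open>c T\<close>.\<close>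

lift_definition scalar_op :: "complex \<Rightarrow> 'h::complex_hilbert \<Rightarrow>\<^sub>L 'h" is scaleC
  by (rule bounded_linear_scaleC)

definition boundedly_invertible :: "('h::complex_hilbert \<Rightarrow>\<^sub>L 'h) \<Rightarrow> bool" where
  "boundedly_invertible T \<longleftrightarrow>
    (\<exists>S\<in>bounded_ops. S o\<^sub>L T = id_blinfun \<and> T o\<^sub>L S = id_blinfun)"

definition op_inv :: "('h::complex_hilbert \<Rightarrow>\<^sub>L 'h) \<Rightarrow> 'h \<Rightarrow>\<^sub>L 'h" where
  "op_inv T = (THE S. S \<in> bounded_ops \<and> S o\<^sub>L T = id_blinfun \<and> T o\<^sub>L S = id_blinfun)"

definition op_adjoint :: "('h::complex_hilbert \<Rightarrow>\<^sub>L 'h) \<Rightarrow> 'h \<Rightarrow>\<^sub>L 'h" where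
  "op_adjoint T = (THE S. S \<in> bounded_ops \<and>
    (\<forall>x y. cinner (blinfun_apply S x) y = cinner x (blinfun_apply T y)))"

definition op_ker :: "('h::complex_hilbert \<Rightarrow>\<^sub>L 'h) \<Rightarrow> 'h set" where
  "op_ker T = {x. blinfun_apply T x = 0}"

definition op_ran :: "('h::complex_hilbert \<Rightarrow>\<^sub>L 'h) \<Rightarrow> 'h set" where
  "op_ran T = range (blinfun_apply T)"

definition fredholm_ops :: "('h::complex_hilbert \<Rightarrow>\<^sub>L 'h) set" where
  "fredholm_ops = {T \<in> bounded_ops. cfinite_dim (op_ker T) \<and> closed (op_ran T) \<and>
    cfinite_dim (op_ker (op_adjoint T))}"

text \<open>The geometric multiplicity of the eigenvalue \<open>0\<close>. The library's dimension of an
  infinite-dimensional space is \<open>0\<close>; kernels of Fredholm operators are finite-dimensional.\<close>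

definition geom_mult0 :: "('h::complex_hilbert \<Rightarrow>\<^sub>L 'h) \<Rightarrow> nat" where
  "geom_mult0 T = complex_vector.dim (op_ker T)"

section \<open>Operator-valued functions of a complex variable\<close>

text \<open>Complex differentiability in operator norm at every point of an open set.\<close>

definition op_analytic_on :: "(complex \<Rightarrow> 'h::complex_hilbert \<Rightarrow>\<^sub>L 'h) \<Rightarrow> complex set \<Rightarrow> bool" where
  "op_analytic_on A \<Omega> \<longleftrightarrow> open \<Omega> \<and>
    (\<forall>z\<in>\<Omega>. \<exists>D. ((\<lambda>w. scalar_op (inverse (w - z)) o\<^sub>L (A w - A z)) \<longlongrightarrow> D) (at z))"

text \<open>\<open>A(\<cdot>)\<inverse>\<close> has a pole of order \<open>n \<ge> 1\<close> at \<open>z\<^sub>0\<close>: in a punctured disc, \<open>A(w)\<close> is boundedly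
  invertible and \<open>A(w)\<inverse>\<close> is the norm convergent sum of \<open>(w - z\<^sub>0)\<^bsup>k - n\<^esup> C\<^sub>k\<close> over \<open>k \<ge> 0\<close>,
  with \<open>C\<^sub>0 \<noteq> 0\<close>.\<close>

definition inverse_pole_order ::
    "(complex \<Rightarrow> 'h::complex_hilbert \<Rightarrow>\<^sub>L 'h) \<Rightarrow> complex \<Rightarrow> nat \<Rightarrow> bool" where
  "inverse_pole_order A z0 n \<longleftrightarrow> 1 \<le> n \<and>
    (\<exists>r>0. \<exists>C :: nat \<Rightarrow> 'h \<Rightarrow>\<^sub>L 'h. range C \<subseteq> bounded_ops \<and> C 0 \<noteq> 0 \<and>
      (\<forall>w\<in>ball z0 r - {z0}. boundedly_invertible (A w) \<and>
        (\<lambda>k. scalar_op ((w - z0) powi (int k - int n)) o\<^sub>L C k) sums op_inv (A w)))"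

definition inverse_has_pole :: "(complex \<Rightarrow> 'h::complex_hilbert \<Rightarrow>\<^sub>L 'h) \<Rightarrow> complex \<Rightarrow> bool" where
  "inverse_has_pole A z0 \<longleftrightarrow> (\<exists>n. inverse_pole_order A z0 n)"

definition inverse_has_simple_pole ::
    "(complex \<Rightarrow> 'h::complex_hilbert \<Rightarrow>\<^sub>L 'h) \<Rightarrow> complex \<Rightarrow> bool" where
  "inverse_has_simple_pole A z0 \<longleftrightarrow> inverse_pole_order A z0 1"

text \<open>The operator-valued analogue of \<^const>\<open>contour_integral\<close>.\<close>

definition op_contour_integral ::
    "(real \<Rightarrow> complex) \<Rightarrow> (complex \<Rightarrow> 'h::complex_hilbert \<Rightarrow>\<^sub>L 'h) \<Rightarrow> 'h \<Rightarrow>\<^sub>L 'h" where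
  "op_contour_integral g f =
    integral {0..1} (\<lambda>t. scalar_op (vector_derivative g (at t within {0..1})) o\<^sub>L f (g t))"

section \<open>Riesz projections and the reduction to finite dimension\<close>

definition riesz_proj :: "real \<Rightarrow> ('h::complex_hilbert \<Rightarrow>\<^sub>L 'h) \<Rightarrow> 'h \<Rightarrow>\<^sub>L 'h" where
  "riesz_proj \<epsilon> B = scalar_op (- 1 / (2 * of_real pi * \<i>)) o\<^sub>L
    op_contour_integral (circlepath 0 \<epsilon>) (\<lambda>\<zeta>. op_inv (B - scalar_op \<zeta>))"

text \<open>\<open>T(z) = P(z\<^sub>0) P(z) + Q(z\<^sub>0) Q(z)\<close> with \<open>Q = I - P\<close>.\<close>

definition transfer_op ::
    "(complex \<Rightarrow> 'h::complex_hilbert \<Rightarrow>\<^sub>L 'h) \<Rightarrow> complex \<Rightarrow> real \<Rightarrow> complex \<Rightarrow> 'h \<Rightarrow>\<^sub>L 'h" where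
  "transfer_op A z0 \<epsilon> z =
    (riesz_proj \<epsilon> (A z0) o\<^sub>L riesz_proj \<epsilon> (A z)) +
    ((id_blinfun - riesz_proj \<epsilon> (A z0)) o\<^sub>L (id_blinfun - riesz_proj \<epsilon> (A z)))"

text \<open>The requirements on \<open>\<epsilon>\<close> and the neighbourhood \<open>N\<close> of \<open>z\<^sub>0\<close> that make the construction
  possible: \<open>0\<close> is the only possible point of the spectrum of \<open>A(z\<^sub>0)\<close> in the closed disc of
  radius \<open>\<epsilon>\<close>, the bounding circle lies in the resolvent set of \<open>A(z)\<close> for all \<open>z \<in> N\<close>, the
  Riesz projections have finite rank and the \<open>T(z)\<close> are boundedly invertible.
  They can be met only if \<open>0\<close> is not an accumulation point of the spectrum of \<open>A(z\<^sub>0)\<close>.\<close>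

definition riesz_admissible ::
    "complex set \<Rightarrow> (complex \<Rightarrow> 'h::complex_hilbert \<Rightarrow>\<^sub>L 'h) \<Rightarrow> complex \<Rightarrow> real \<Rightarrow> complex set \<Rightarrow> bool"
  where
  "riesz_admissible \<Omega> A z0 \<epsilon> N \<longleftrightarrow>
    0 < \<epsilon> \<and> open N \<and> connected N \<and> z0 \<in> N \<and> N \<subseteq> \<Omega> \<and>
    (\<forall>\<zeta>\<in>cball 0 \<epsilon> - {0}. boundedly_invertible (A z0 - scalar_op \<zeta>)) \<and>
    (\<forall>z\<in>N. \<forall>\<zeta>\<in>sphere 0 \<epsilon>. boundedly_invertible (A z - scalar_op \<zeta>)) \<and>
    (\<forall>z\<in>N. cfinite_dim (op_ran (riesz_proj \<epsilon> (A z)))) \<and>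
    (\<forall>z\<in>N. boundedly_invertible (transfer_op A z0 \<epsilon> z))"

text \<open>The determinant of the restriction of \<open>f\<close> to a finite-dimensional subspace \<open>V\<close> with
  \<open>f(V) \<subseteq> V\<close>, through its matrix in some basis of \<open>V\<close>; column \<open>j\<close> holds the
  coordinates of the image of the \<open>j\<close>-th basis vector.\<close>

definition det_on :: "'h::complex_hilbert set \<Rightarrow> ('h \<Rightarrow> 'h) \<Rightarrow> complex" where
  "det_on V f =
    (let bs = (SOME bs. distinct bs \<and> complex_vector.independent (set bs) \<and>
                        complex_vector.span (set bs) = V)
     in Determinant.det (Matrix.mat (length bs) (length bs)
          (\<lambda>(i, j). complex_vector.representation (set bs) (f (bs ! j)) (bs ! i))))"

text \<open>\<open>T(z) A(z) T(z)\<inverse>\<close> leaves \<open>ran P(z\<^sub>0)\<close> invariant; the block \<open>F(z)\<close> is its restriction.\<close>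

definition block_det ::
    "(complex \<Rightarrow> 'h::complex_hilbert \<Rightarrow>\<^sub>L 'h) \<Rightarrow> complex \<Rightarrow> real \<Rightarrow> complex \<Rightarrow> complex" where
  "block_det A z0 \<epsilon> z = det_on (op_ran (riesz_proj \<epsilon> (A z0)))
    (blinfun_apply (transfer_op A z0 \<epsilon> z o\<^sub>L A z o\<^sub>L op_inv (transfer_op A z0 \<epsilon> z)))"

text \<open>\<open>\<nu>(z\<^sub>0; A(\<cdot>))\<close>, computed from admissible \<open>\<epsilon>\<close> and \<open>N\<close>.\<close>

definition nu ::
    "(complex \<Rightarrow> 'h::complex_hilbert \<Rightarrow>\<^sub>L 'h) \<Rightarrow> complex \<Rightarrow> real \<Rightarrow> complex set \<Rightarrow> enat" where
  "nu A z0 \<epsilon> N =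
    (if \<forall>z\<in>N. block_det A z0 \<epsilon> z = 0 then \<infinity>
     else enat (nat (zorder (block_det A z0 \<epsilon>) z0)))"

end

theory Submission
  imports Defs
begin

text \<open>
  Let \<open>A\<^sub>0 = A(z\<^sub>0)\<close>, \<open>D = A'(z\<^sub>0)\<close> and \<open>m = dim ker A\<^sub>0\<close>. Comparing Laurent coefficients in
  \<open>A(z)\<inverse> A(z) = I = A(z) A(z)\<inverse>\<close> shows that the pole is simple iff no nonzero \<open>u \<in> ker A\<^sub>0\<close>
  satisfies \<open>D u \<in> ran A\<^sub>0\<close>. On the other hand \<open>F(z) P(z\<^sub>0) P(z) = P(z\<^sub>0) P(z) A(z)\<close> on
  \<open>V = ran P(z\<^sub>0)\<close>, so near \<open>z\<^sub>0\<close> the determinant of \<open>F\<close> vanishes to the same order as that of the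
  right-hand side. In a basis of \<open>V\<close> extending one of \<open>ker A\<^sub>0 \<subseteq> V\<close>, the first \<open>m\<close> columns of
  the latter are divisible by \<open>z - z\<^sub>0\<close>; after the division its value at \<open>z\<^sub>0\<close> has the columns
  \<open>P(z\<^sub>0) D u\<close> for the basis vectors \<open>u\<close> of the kernel and \<open>A\<^sub>0 v\<close> for the others. It is
  singular iff \<open>D u \<in> ran A\<^sub>0\<close> for some nonzero \<open>u \<in> ker A\<^sub>0\<close>, because \<open>A\<^sub>0\<close> is invertible modulo
  \<open>P(z\<^sub>0)\<close>. Hence \<open>\<nu> \<ge> m\<close>, with equality iff the pole is simple.

  That \<open>P\<close> is idempotent is obtained from Riemann sums: with \<open>b = (B/\<epsilon>)\<^sup>n\<close>, the sums of the
  contour integral over two interlaced sets of \<open>n\<close> equidistant nodes are \<open>(1 - b)\<inverse>\<close> and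
  \<open>(1 + b)\<inverse>\<close>, whose mean is their product.
\<close>

section \<open>Complex Hilbert spaces and bounded operators\<close>

lemma cinner_add_left: "cinner (x + y) z = cinner x z + cinner y (z :: 'h::complex_hilbert)"
  by (metis cinner_add_right cinner_commute complex_cnj_add)

lemma cinner_scaleC_left: "cinner (c *\<^sub>C x) y = cnj c * cinner x (y :: 'h::complex_hilbert)"
  by (metis cinner_commute cinner_scaleC_right complex_cnj_mult)

lemma cinner_zero_right [simp]: "cinner x (0 :: 'h::complex_hilbert) = 0"
  using cinner_add_right[of x 0 0] by simp

lemma cinner_zero_left [simp]: "cinner (0 :: 'h::complex_hilbert) x = 0"
  using cinner_add_left[of 0 0 x] by simp

lemma cinner_minus_right: "cinner x (- y) = - cinner x (y :: 'h::complex_hilbert)"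
  using cinner_add_right[of x y "- y"] by (simp add: add_eq_0_iff)

lemma cinner_diff_right: "cinner x (y - z) = cinner x y - cinner x (z :: 'h::complex_hilbert)"
  using cinner_add_right[of x y "- z"] by (simp add: cinner_minus_right)

lemma cinner_sum_right: "cinner x (\<Sum>i\<in>I. f i) = (\<Sum>i\<in>I. cinner x (f i :: 'h::complex_hilbert))"
  by (induction I rule: infinite_finite_induct) (simp_all add: cinner_add_right)

lemma cinner_self_eq_0_iff: "cinner x x = 0 \<longleftrightarrow> x = (0 :: 'h::complex_hilbert)"
  by (simp add: cinner_self)

text \<open>Cauchy-Schwarz by Pythagoras: \<open>c *\<^sub>C x\<close> is the component of
  \<open>y\<close> along \<open>x\<close>, and the remainder \<open>w\<close> is orthogonal to
  it.\<close>

lemma cinner_norm_bound: "cmod (cinner x y) \<le> norm x * norm (y :: 'h::complex_hilbert)"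
proof (cases "x = 0")
  case False
  define c where "c = cinner x y / complex_of_real ((norm x)\<^sup>2)"
  have n: "norm x > 0" using False by simp
  have ns: "complex_of_real ((norm x)\<^sup>2) \<noteq> 0" using n by simp
  have c1: "c * cinner x x = cinner x y"
    unfolding c_def cinner_self using ns by (metis nonzero_eq_divide_eq)
  define w where "w = y - c *\<^sub>C x"
  have ortho: "cinner x w = 0"
    by (simp add: w_def cinner_diff_right cinner_scaleC_right c1)
  have "cinner w x = 0"
    using ortho cinner_commute[of w x] by simp
  then have yy: "cinner y y = cinner w w + cnj c * c * cinner x x"
    using ortho unfolding w_def
    by (simp add: cinner_diff_right cinner_scaleC_right cinner_scaleC_left algebra_simps
        cinner_add_left[of "y - c *\<^sub>C x" "c *\<^sub>C x", simplified])
  have "cnj c * c * cinner x x = complex_of_real ((cmod c * norm x)\<^sup>2)"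
    by (metis cinner_self complex_norm_square mult.commute of_real_mult power_mult_distrib)
  with yy have "complex_of_real ((norm y)\<^sup>2)
      = complex_of_real ((norm w)\<^sup>2 + (cmod c * norm x)\<^sup>2)"
    by (simp add: cinner_self)
  then have "(norm y)\<^sup>2 = (norm w)\<^sup>2 + (cmod c * norm x)\<^sup>2"
    by (simp only: of_real_eq_iff)
  then have "(cmod c * norm x)\<^sup>2 \<le> (norm y)\<^sup>2" by simp
  then have "cmod c * norm x \<le> norm y"
    using norm_ge_zero power2_le_imp_le by blast
  moreover have "cmod (cinner x y) = cmod c * norm x * norm x"
    by (simp add: c1[symmetric] norm_mult cinner_self power2_eq_square norm_power del: of_real_power of_real_mult)
  ultimately show ?thesis
    using n by (simp add: mult.commute[of "norm x"])
qed simp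

lemma bounded_linear_cinner: "bounded_linear (cinner (x :: 'h::complex_hilbert))"
proof (rule bounded_linear_intro[where K = "norm x"])
  show "cinner x (r *\<^sub>R y) = r *\<^sub>R cinner x y" for r y
    by (simp add: scaleR_scaleC cinner_scaleC_right scaleR_conv_of_real)
  show "norm (cinner x y) \<le> norm y * norm x" for y
    using cinner_norm_bound[of x y] by (simp add: mult.commute)
qed (rule cinner_add_right)

lemma scaleC_tendsto:
  fixes f :: "'a \<Rightarrow> complex" and g :: "'a \<Rightarrow> 'h::complex_hilbert"
  assumes "(f \<longlongrightarrow> a) F" "(g \<longlongrightarrow> b) F"
  shows "((\<lambda>x. f x *\<^sub>C g x) \<longlongrightarrow> a *\<^sub>C b) F"
proof -
  have "bounded_bilinear (\<lambda>c (x :: 'h). c *\<^sub>C x)"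
  proof
    show "\<exists>K. \<forall>a b. norm (a *\<^sub>C (b :: 'h)) \<le> norm a * norm b * K"
      by (rule exI[of _ 1]) (simp add: norm_scaleC)
  qed (simp_all add: scaleC_add_right scaleC_add_left scaleR_scaleC scaleC_scaleC scaleR_conv_of_real mult.commute)
  then show ?thesis using assms by (rule bounded_bilinear.tendsto)
qed

section \<open>Complex-linear operators and scalar multiples\<close>

lemma bounded_ops_scaleC: "T \<in> bounded_ops \<Longrightarrow> blinfun_apply T (c *\<^sub>C x) = c *\<^sub>C blinfun_apply T x"
  by (simp add: bounded_ops_def)

lemma scalar_op_apply [simp]: "blinfun_apply (scalar_op c) x = c *\<^sub>C x"
  by (simp add: scalar_op.rep_eq)

text \<open>Commutation with scalars passes through operator-valued integrals; in this form Riesz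
  projections are seen to be complex-linear.\<close>

lemma bounded_opsI_commute:
  assumes "\<And>c. T o\<^sub>L scalar_op c = scalar_op c o\<^sub>L T"
  shows "T \<in> bounded_ops"
proof -
  have "blinfun_apply T (c *\<^sub>C x) = c *\<^sub>C blinfun_apply T x" for c x
    using arg_cong[OF assms[of c], of "\<lambda>S. blinfun_apply S x"] by simp
  then show ?thesis by (simp add: bounded_ops_def)
qed

lemma bounded_ops_commute:
  assumes "T \<in> bounded_ops"
  shows "T o\<^sub>L scalar_op c = scalar_op c o\<^sub>L T"
  using assms by (intro blinfun_eqI) (simp add: bounded_ops_scaleC)

lemma bounded_ops_id [simp]: "id_blinfun \<in> bounded_ops"
  and bounded_ops_scalar [simp]: "scalar_op c \<in> bounded_ops"
  and bounded_ops_compose: "S \<in> bounded_ops \<Longrightarrow> T \<in> bounded_ops \<Longrightarrow> S o\<^sub>L T \<in> bounded_ops"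
  and bounded_ops_add: "S \<in> bounded_ops \<Longrightarrow> T \<in> bounded_ops \<Longrightarrow> S + T \<in> bounded_ops"
  and bounded_ops_diff: "S \<in> bounded_ops \<Longrightarrow> T \<in> bounded_ops \<Longrightarrow> S - T \<in> bounded_ops"
  by (simp_all add: bounded_ops_def scaleC_scaleC mult.commute blinfun.add_left blinfun.diff_left
      scaleC_add_right complex_vector.scale_right_diff_distrib)

lemma norm_scalar_op_le: "norm (scalar_op c :: 'h::complex_hilbert \<Rightarrow>\<^sub>L 'h) \<le> cmod c"
  by (rule norm_blinfun_bound) (simp_all add: norm_scaleC)

lemma norm_scalar_op_compose: "norm (scalar_op c o\<^sub>L T) = cmod c * norm T"
proof (rule antisym)
  show "norm (scalar_op c o\<^sub>L T) \<le> cmod c * norm T"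
    by (rule norm_blinfun_bound)
      (auto simp: norm_scaleC mult.assoc intro!: mult_left_mono norm_blinfun)
  show "cmod c * norm T \<le> norm (scalar_op c o\<^sub>L T)"
  proof (cases "c = 0")
    case False
    have "norm T \<le> norm (scalar_op c o\<^sub>L T) / cmod c"
    proof (rule norm_blinfun_bound)
      show "norm (blinfun_apply T x) \<le> norm (scalar_op c o\<^sub>L T) / cmod c * norm x" for x
        using False norm_blinfun[of "scalar_op c o\<^sub>L T" x]
        by (simp add: norm_scaleC field_simps)
    qed simp
    then show ?thesis using False by (simp add: field_simps)
  qed simp
qed

lemma scalar_op_add: "scalar_op (a + b) = scalar_op a + scalar_op b"
  and scalar_op_0 [simp]: "scalar_op 0 = 0"
  and scalar_op_1 [simp]: "scalar_op 1 = id_blinfun"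
  by (auto intro!: blinfun_eqI simp: blinfun.add_left scaleC_add_left)

lemma bounded_linear_scalar_op: "bounded_linear (scalar_op :: complex \<Rightarrow> 'h::complex_hilbert \<Rightarrow>\<^sub>L 'h)"
proof (rule bounded_linear_intro[where K = 1])
  show "scalar_op (r *\<^sub>R x) = r *\<^sub>R (scalar_op x :: 'h \<Rightarrow>\<^sub>L 'h)" for r x
    by (rule blinfun_eqI)
      (simp add: blinfun.scaleR_left scaleR_scaleC scaleC_scaleC scaleR_conv_of_real)
qed (simp_all add: scalar_op_add norm_scalar_op_le)

lemmas tendsto_blinfun_compose = bounded_bilinear.tendsto[OF bounded_bilinear_blinfun_compose]
  and continuous_on_blinfun_compose = bounded_bilinear.continuous_on[OF bounded_bilinear_blinfun_compose]
  and tendsto_scalar_op = bounded_linear.tendsto[OF bounded_linear_scalar_op]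
  and continuous_on_scalar_op = bounded_linear.continuous_on[OF bounded_linear_scalar_op]

section \<open>Inverses and their continuity\<close>

lemma
  assumes "boundedly_invertible T"
  shows op_inv_bounded_ops: "op_inv T \<in> bounded_ops"
    and op_inv_left: "op_inv T o\<^sub>L T = id_blinfun"
    and op_inv_right: "T o\<^sub>L op_inv T = id_blinfun"
proof -
  from assms obtain S where S: "S \<in> bounded_ops" "S o\<^sub>L T = id_blinfun" "T o\<^sub>L S = id_blinfun"
    unfolding boundedly_invertible_def by blast
  have "\<exists>!S. S \<in> bounded_ops \<and> S o\<^sub>L T = id_blinfun \<and> T o\<^sub>L S = id_blinfun"
  proof (rule ex1I[of _ S])
    fix S' assume "S' \<in> bounded_ops \<and> S' o\<^sub>L T = id_blinfun \<and> T o\<^sub>L S' = id_blinfun"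
    then have "S' = S' o\<^sub>L (T o\<^sub>L S)" and "(S' o\<^sub>L T) o\<^sub>L S = S"
      by (auto intro: blinfun_eqI simp: S(3))
    moreover have "S' o\<^sub>L (T o\<^sub>L S) = (S' o\<^sub>L T) o\<^sub>L S"
      by (rule blinfun_eqI) simp
    ultimately show "S' = S" by simp
  qed (use S in blast)
  from theI'[OF this]
  show "op_inv T \<in> bounded_ops" "op_inv T o\<^sub>L T = id_blinfun" "T o\<^sub>L op_inv T = id_blinfun"
    unfolding op_inv_def by blast+
qed

lemma op_inv_left_apply: "boundedly_invertible T \<Longrightarrow> blinfun_apply (op_inv T) (blinfun_apply T x) = x"
  and op_inv_right_apply: "boundedly_invertible T \<Longrightarrow> blinfun_apply T (blinfun_apply (op_inv T) x) = x"
  using op_inv_left[of T] op_inv_right[of T]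
  by (metis blinfun_apply_blinfun_compose id_blinfun.rep_eq)+

text \<open>With \<open>R\<close> the inverse of \<open>B\<close>, the inverses differ by C^-1 (B -
  C) R. Once norm (B - C) * norm R < 1/2, this is at most half of norm C^-1, hence norm C^-1 is at
  most 2 * norm R, and the difference is linearly small in B - C.\<close>

lemma tendsto_op_inv:
  fixes f :: "'a \<Rightarrow> 'h::complex_hilbert \<Rightarrow>\<^sub>L 'h"
  assumes lim: "(f \<longlongrightarrow> B) F" and B: "boundedly_invertible B"
    and inv: "\<forall>\<^sub>F x in F. boundedly_invertible (f x)"
  shows "((\<lambda>x. op_inv (f x)) \<longlongrightarrow> op_inv B) F"
proof -
  define R where "R = op_inv B"
  have diff: "op_inv C - R = op_inv C o\<^sub>L (B - C) o\<^sub>L R" if "boundedly_invertible C" for C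
    by (rule blinfun_eqI)
      (simp add: R_def that B op_inv_left_apply op_inv_right_apply blinfun.diff_left blinfun.diff_right)
  have diff_le: "norm (op_inv C - R) \<le> norm (op_inv C) * (norm (B - C) * norm R)"
    if "boundedly_invertible C" for C
  proof -
    have "norm (op_inv C o\<^sub>L (B - C) o\<^sub>L R) \<le> norm (op_inv C o\<^sub>L (B - C)) * norm R"
      by (rule norm_blinfun_compose)
    also have "\<dots> \<le> norm (op_inv C) * norm (B - C) * norm R"
      by (intro mult_right_mono norm_blinfun_compose norm_ge_zero)
    finally show ?thesis using diff[OF that] by (simp add: mult.assoc)
  qed
  have small: "((\<lambda>x. norm (B - f x) * norm R) \<longlongrightarrow> 0) F"
    using tendsto_mult_left_zero[OF tendsto_norm_zero[OF LIM_zero[OF lim]], of "norm R"]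
    by (simp add: norm_minus_commute)
  then have "\<forall>\<^sub>F x in F. norm (B - f x) * norm R < 1/2"
    by (rule order_tendstoD) simp
  then have ev: "\<forall>\<^sub>F x in F. norm (op_inv (f x) - R) \<le> 2 * norm R * (norm (B - f x) * norm R)"
    using inv
  proof eventually_elim
    case (elim x)
    have "norm (op_inv (f x)) * (norm (B - f x) * norm R) \<le> norm (op_inv (f x)) * (1/2)"
      using elim by (intro mult_left_mono) auto
    with diff_le[OF elim(2)] have "norm (op_inv (f x) - R) \<le> norm (op_inv (f x)) / 2" by simp
    then have "norm (op_inv (f x)) \<le> 2 * norm R"
      using norm_triangle_sub[of "op_inv (f x)" R] by simp
    then have "norm (op_inv (f x)) * (norm (B - f x) * norm R) \<le> 2 * norm R * (norm (B - f x) * norm R)"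
      by (intro mult_right_mono) auto
    with diff_le[OF elim(2)] show ?case by linarith
  qed
  have "((\<lambda>x. op_inv (f x) - R) \<longlongrightarrow> 0) F"
    by (rule Lim_null_comparison[OF ev]) (use tendsto_mult_right_zero[OF small] in blast)
  then show ?thesis
    unfolding R_def by (rule LIM_zero_cancel)
qed

section \<open>Riesz projections\<close>

text \<open>Each subinterval of length 1/N contributes an error of at most e/N. The bound is
  explicit so that it can be made uniform in a parameter; \<theta> places the node within its
  subinterval.\<close>

lemma riemann_sum_dist:
  fixes g :: "real \<Rightarrow> 'a::banach"
  assumes cont: "continuous_on {0..1} g"
    and e: "\<And>s t. s \<in> {0..1} \<Longrightarrow> t \<in> {0..1} \<Longrightarrow> \<bar>s - t\<bar> \<le> d \<Longrightarrow> norm (g s - g t) \<le> e"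
    and N: "N > 0" "1 / real N \<le> d" and \<theta>: "0 \<le> \<theta>" "\<theta> \<le> 1"
  shows "norm (integral {0..1} g - (\<Sum>k<N. (1 / real N) *\<^sub>R g ((real k + \<theta>) / real N))) \<le> e"
proof -
  \<comment> \<open>Induction over the first \<open>n\<close> of the \<open>N\<close>
    subintervals.\<close>
  have "norm (integral {0..real n / real N} g -
      (\<Sum>k<n. (1 / real N) *\<^sub>R g ((real k + \<theta>) / real N))) \<le> real n / real N * e" if "n \<le> N" for n
    using that
  proof (induction n)
    case (Suc n)
    define a b c where "a = real n / real N" and "b = real (Suc n) / real N"
      and "c = (real n + \<theta>) / real N"
    have ab: "0 \<le> a" "a \<le> b" "b \<le> 1" "b - a = 1 / real N"
      using Suc.prems N by (simp_all add: a_def b_def divide_simps)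
    have c: "a \<le> c" "c \<le> b" using N \<theta> by (simp_all add: a_def b_def c_def divide_simps)
    have cont': "continuous_on {a..b} g" "continuous_on {0..b} g"
      using ab by (auto intro: continuous_on_subset[OF cont])
    have split: "integral {0..b} g = integral {0..a} g + integral {a..b} g"
      using ab cont' by (intro Henstock_Kurzweil_Integration.integral_combine[symmetric] integrable_continuous_real) auto
    have "integral {a..b} g - (1 / real N) *\<^sub>R g c = integral {a..b} (\<lambda>t. g t - g c)"
      using ab cont' by (subst integral_diff) (auto intro: integrable_continuous_real)
    also have "norm \<dots> \<le> e * (b - a)"
    proof (rule integral_bound)
      show "norm (g t - g c) \<le> e" if "t \<in> {a..b}" for t
        using that ab c N by (intro e) auto
    qed (use ab cont' in \<open>auto intro!: continuous_intros\<close>)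
    finally have "norm (integral {a..b} g - (1 / real N) *\<^sub>R g c) \<le> e * (1 / real N)"
      using ab by simp
    moreover have "norm (integral {0..a} g -
        (\<Sum>k<n. (1 / real N) *\<^sub>R g ((real k + \<theta>) / real N))) \<le> a * e"
      using Suc by (simp add: a_def)
    ultimately have "norm ((integral {0..a} g - (\<Sum>k<n. (1 / real N) *\<^sub>R g ((real k + \<theta>) / real N)))
        + (integral {a..b} g - (1 / real N) *\<^sub>R g c)) \<le> a * e + e * (1 / real N)"
      by (rule norm_triangle_le[OF add_mono, rotated])
    also have "a * e + e * (1 / real N) = b * e"
      unfolding ab(4)[symmetric] by (simp add: algebra_simps)
    finally show ?case
      by (simp only: split b_def[symmetric] c_def[symmetric] sum.lessThan_Suc add_diff_add)
  qed simp
  from this[of N] N show ?thesis by simp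
qed

lemma riemann_sum_tendsto:
  fixes g :: "real \<Rightarrow> 'a::banach"
  assumes cont: "continuous_on {0..1} g" and \<theta>: "0 \<le> \<theta>" "\<theta> \<le> 1"
  shows "(\<lambda>N. \<Sum>k<N. (1 / real N) *\<^sub>R g ((real k + \<theta>) / real N)) \<longlonglongrightarrow> integral {0..1} g"
proof (rule tendstoI)
  fix e :: real assume e: "e > 0"
  have "uniformly_continuous_on {0..1} g"
    using cont by (simp add: compact_uniformly_continuous)
  then obtain d where d: "d > 0"
    "\<And>s t. s \<in> {0..1} \<Longrightarrow> t \<in> {0..1} \<Longrightarrow> dist t s < d \<Longrightarrow> dist (g t) (g s) < e / 2"
    using e unfolding uniformly_continuous_on_def by (metis half_gt_zero)
  have "\<forall>\<^sub>F N in sequentially. 1 / real N < d / 2"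
    using d(1) by (intro order_tendstoD[OF lim_1_over_n]) auto
  then show "\<forall>\<^sub>F N in sequentially.
      dist (\<Sum>k<N. (1 / real N) *\<^sub>R g ((real k + \<theta>) / real N)) (integral {0..1} g) < e"
    using eventually_gt_at_top[of "0::nat"]
  proof eventually_elim
    case (elim N)
    have "norm (integral {0..1} g - (\<Sum>k<N. (1 / real N) *\<^sub>R g ((real k + \<theta>) / real N))) \<le> e / 2"
    proof (rule riemann_sum_dist[OF cont _ _ _ \<theta>])
      fix s t :: real assume "s \<in> {0..1}" "t \<in> {0..1}" "\<bar>s - t\<bar> \<le> d / 2"
      then have "dist (g s) (g t) < e / 2"
        using d(1) by (intro d(2)) (auto simp: dist_real_def)
      then show "norm (g s - g t) \<le> e / 2" by (simp add: dist_norm)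
    qed (use elim in auto)
    then show ?case using e by (simp add: dist_norm norm_minus_commute)
  qed
qed

section \<open>The resolvent on a circle\<close>

text \<open>On the circle, \<zeta>' = 2 pi i \<zeta> cancels the factor 1/(2 pi i) of the Riesz
  projection. What remains of the integrand is -\<zeta> (B - \<zeta>)^-1 = (1 -
  B/\<zeta>)^-1.\<close>

definition circle_resolvent :: "real \<Rightarrow> ('h::complex_hilbert \<Rightarrow>\<^sub>L 'h) \<Rightarrow> real \<Rightarrow> 'h \<Rightarrow>\<^sub>L 'h" where
  "circle_resolvent \<epsilon> B t =
    scalar_op (- circlepath 0 \<epsilon> t) o\<^sub>L op_inv (B - scalar_op (circlepath 0 \<epsilon> t))"

lemma circlepath_sphere: "0 < \<epsilon> \<Longrightarrow> circlepath 0 \<epsilon> t \<in> sphere 0 \<epsilon>"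
  by (simp add: circlepath norm_mult)

lemma continuous_on_circlepath: "continuous_on S (circlepath 0 \<epsilon>)"
  unfolding circlepath by (intro continuous_intros)

lemma integral_commute:
  fixes f :: "real \<Rightarrow> 'h::complex_hilbert \<Rightarrow>\<^sub>L 'h"
  assumes int: "f integrable_on S" and comm: "\<And>t. t \<in> S \<Longrightarrow> X o\<^sub>L f t = f t o\<^sub>L X"
  shows "X o\<^sub>L integral S f = integral S f o\<^sub>L X"
proof -
  have "X o\<^sub>L integral S f = integral S (\<lambda>t. X o\<^sub>L f t)"
    using integral_linear[OF int bounded_bilinear.bounded_linear_right[OF bounded_bilinear_blinfun_compose, of X]] by (simp add: o_def)
  also have "\<dots> = integral S (\<lambda>t. f t o\<^sub>L X)"
    using comm by (intro integral_cong) simp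
  also have "\<dots> = integral S f o\<^sub>L X"
    using integral_linear[OF int bounded_bilinear.bounded_linear_left[OF bounded_bilinear_blinfun_compose, of X]] by (simp add: o_def)
  finally show ?thesis .
qed

text \<open>Concerns one operator with the circle in its resolvent set. Spectrum inside the disc is
  allowed, because every \<open>A z\<close> with \<open>z\<close> in \<open>N\<close> is an
  instance.\<close>

locale resolvent_circle =
  fixes B :: "'h::complex_hilbert \<Rightarrow>\<^sub>L 'h" and \<epsilon> :: real
  assumes eps: "0 < \<epsilon>" and B: "B \<in> bounded_ops"
    and circle: "\<And>\<zeta>. \<zeta> \<in> sphere 0 \<epsilon> \<Longrightarrow> boundedly_invertible (B - scalar_op \<zeta>)"
begin

lemma invertible: "boundedly_invertible (B - scalar_op (circlepath 0 \<epsilon> t))"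
  using circlepath_sphere[OF eps] by (rule circle)

lemma circlepath_nonzero: "circlepath 0 \<epsilon> t \<noteq> 0"
  using eps by (simp add: circlepath)

lemma resolvent_commute:
  "blinfun_apply (op_inv (B - scalar_op (circlepath 0 \<epsilon> t))) (blinfun_apply B x)
    = blinfun_apply B (blinfun_apply (op_inv (B - scalar_op (circlepath 0 \<epsilon> t))) x)"
proof -
  let ?\<zeta> = "circlepath 0 \<epsilon> t" let ?R = "op_inv (B - scalar_op ?\<zeta>)"
  have "blinfun_apply ?R (blinfun_apply B x) =
      x + ?\<zeta> *\<^sub>C blinfun_apply ?R x"
    using op_inv_left_apply[OF invertible, of t x] bounded_ops_scaleC[OF op_inv_bounded_ops[OF invertible], of t ?\<zeta> x]
    by (simp add: blinfun.diff_left blinfun.diff_right algebra_simps)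
  also have "\<dots> = blinfun_apply B (blinfun_apply ?R x)"
    using op_inv_right_apply[OF invertible, of t x]
    by (simp add: blinfun.diff_left algebra_simps)
  finally show ?thesis .
qed

lemma circle_resolvent_bounded_ops: "circle_resolvent \<epsilon> B t \<in> bounded_ops"
  unfolding circle_resolvent_def
  by (intro bounded_ops_compose bounded_ops_scalar op_inv_bounded_ops invertible)

lemma circle_resolvent_commute:
  "blinfun_apply (circle_resolvent \<epsilon> B t) (blinfun_apply B x)
    = blinfun_apply B (blinfun_apply (circle_resolvent \<epsilon> B t) x)"
  by (simp add: circle_resolvent_def resolvent_commute bounded_ops_scaleC[OF B] blinfun.minus_right)

lemma circle_resolvent_left_inverse:
  "blinfun_apply (circle_resolvent \<epsilon> B t) (x - inverse (circlepath 0 \<epsilon> t) *\<^sub>C blinfun_apply B x) = x"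
proof -
  let ?\<zeta> = "circlepath 0 \<epsilon> t"
  have "(- ?\<zeta>) *\<^sub>C (x - inverse ?\<zeta> *\<^sub>C blinfun_apply B x) = blinfun_apply (B - scalar_op ?\<zeta>) x"
    using circlepath_nonzero[of t]
    by (simp add: complex_vector.scale_right_diff_distrib scaleC_scaleC blinfun.diff_left)
  then show ?thesis
    by (metis circle_resolvent_def blinfun_apply_blinfun_compose scalar_op_apply
        bounded_ops_scaleC[OF op_inv_bounded_ops[OF invertible]] op_inv_left_apply[OF invertible])
qed

text \<open>The finite geometric sum for (1 - B/\<zeta>)^-1. It replaces the Neumann series, which
  need not converge, and involves \<zeta> on the left only through the resolvent and
  \<zeta>^n.\<close>

lemma circle_resolvent_telescope:
  "blinfun_apply (circle_resolvent \<epsilon> B t)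
      (x - (inverse (circlepath 0 \<epsilon> t) ^ n) *\<^sub>C (blinfun_apply B ^^ n) x)
    = (\<Sum>j<n. (inverse (circlepath 0 \<epsilon> t) ^ j) *\<^sub>C (blinfun_apply B ^^ j) x)"
proof (induction n)
  case (Suc n)
  let ?\<alpha> = "inverse (circlepath 0 \<epsilon> t)"
  define u where "u = (?\<alpha> ^ n) *\<^sub>C (blinfun_apply B ^^ n) x"
  have "x - (?\<alpha> ^ Suc n) *\<^sub>C (blinfun_apply B ^^ Suc n) x
      = (x - u) + (u - ?\<alpha> *\<^sub>C blinfun_apply B u)"
    by (simp add: u_def bounded_ops_scaleC[OF B] scaleC_scaleC)
  then show ?case
    using Suc circle_resolvent_left_inverse[of t u]
    by (simp only: blinfun.add_right sum.lessThan_Suc flip: u_def)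
qed simp

lemma continuous_on_resolvent:
  "continuous_on S (\<lambda>t. op_inv (B - scalar_op (circlepath 0 \<epsilon> t)))"
proof -
  have "((\<lambda>t. B - scalar_op (circlepath 0 \<epsilon> t)) \<longlongrightarrow> B - scalar_op (circlepath 0 \<epsilon> t)) (at t within S)"
    if "t \<in> S" for t
    using continuous_on_circlepath[of S \<epsilon>] that
    by (intro tendsto_diff tendsto_const tendsto_scalar_op) (auto simp: continuous_on_def)
  then show ?thesis
    unfolding continuous_on_def by (auto intro!: tendsto_op_inv invertible always_eventually)
qed

lemma continuous_on_circle_resolvent: "continuous_on S (circle_resolvent \<epsilon> B)"
  unfolding circle_resolvent_def
  by (intro continuous_on_blinfun_compose continuous_on_scalar_op continuous_on_minus
      continuous_on_circlepath continuous_on_resolvent)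

lemma riesz_proj_eq_integral: "riesz_proj \<epsilon> B = integral {0..1} (circle_resolvent \<epsilon> B)"
proof -
  let ?R = "\<lambda>t. op_inv (B - scalar_op (circlepath 0 \<epsilon> t))"
  have "op_contour_integral (circlepath 0 \<epsilon>) (\<lambda>\<zeta>. op_inv (B - scalar_op \<zeta>))
      = integral {0..1} (\<lambda>t. scalar_op (- (2 * of_real pi * \<i>)) o\<^sub>L circle_resolvent \<epsilon> B t)"
    unfolding op_contour_integral_def
  proof (rule integral_cong)
    fix t :: real assume "t \<in> {0..1}"
    then have "vector_derivative (circlepath 0 \<epsilon>) (at t within {0..1})
        = - (2 * of_real pi * \<i>) * - circlepath 0 \<epsilon> t"
      by (subst vector_derivative_circlepath01) (simp_all add: circlepath)
    then show "scalar_op (vector_derivative (circlepath 0 \<epsilon>) (at t within {0..1})) o\<^sub>L ?R t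
        = scalar_op (- (2 * of_real pi * \<i>)) o\<^sub>L circle_resolvent \<epsilon> B t"
      by (auto intro!: blinfun_eqI simp: circle_resolvent_def scaleC_scaleC)
  qed
  also have "\<dots> = scalar_op (- (2 * of_real pi * \<i>)) o\<^sub>L integral {0..1} (circle_resolvent \<epsilon> B)"
    using integral_linear[OF integrable_continuous_real[OF continuous_on_circle_resolvent]
        bounded_bilinear.bounded_linear_right[OF bounded_bilinear_blinfun_compose]] by (simp add: o_def)
  finally show ?thesis
    unfolding riesz_proj_def by (auto intro!: blinfun_eqI simp: scaleC_scaleC)
qed

lemma integrable_circle_resolvent: "circle_resolvent \<epsilon> B integrable_on {0..1}"
  by (rule integrable_continuous_real[OF continuous_on_circle_resolvent])

lemma riesz_proj_bounded_ops: "riesz_proj \<epsilon> B \<in> bounded_ops"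
  unfolding riesz_proj_eq_integral
  by (rule bounded_opsI_commute, rule sym, rule integral_commute[OF integrable_circle_resolvent])
    (simp add: bounded_ops_commute[OF circle_resolvent_bounded_ops])

lemma riesz_proj_commute:
  "blinfun_apply (riesz_proj \<epsilon> B) (blinfun_apply B x) = blinfun_apply B (blinfun_apply (riesz_proj \<epsilon> B) x)"
proof -
  have "B o\<^sub>L riesz_proj \<epsilon> B = riesz_proj \<epsilon> B o\<^sub>L B"
    unfolding riesz_proj_eq_integral
    by (rule integral_commute[OF integrable_circle_resolvent])
      (auto intro!: blinfun_eqI simp: circle_resolvent_commute)
  from arg_cong[OF this, of "\<lambda>S. blinfun_apply S x"] show ?thesis by simp
qed

text \<open>\<open>B\<close> is invertible modulo \<open>P\<close>: since \<open>B R(\<zeta>) = I + \<zeta> R(\<zeta>)\<close>, the mean of \<open>R\<close> over the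
  circle is a two-sided inverse of \<open>B\<close> up to \<open>P\<close>.\<close>

lemma riesz_proj_complement_inverse:
  "\<exists>S. \<forall>x. blinfun_apply B (blinfun_apply S x) = x - blinfun_apply (riesz_proj \<epsilon> B) x \<and>
    blinfun_apply S (blinfun_apply B x) = x - blinfun_apply (riesz_proj \<epsilon> B) x"
proof (intro exI allI conjI)
  let ?R = "\<lambda>t. op_inv (B - scalar_op (circlepath 0 \<epsilon> t))"
  define S where "S = integral {0..1} ?R"
  have int: "?R integrable_on {0..1}"
    by (rule integrable_continuous_real[OF continuous_on_resolvent])
  have BR: "B o\<^sub>L ?R t = id_blinfun - circle_resolvent \<epsilon> B t" for t
  proof (rule blinfun_eqI)
    fix x
    show "blinfun_apply (B o\<^sub>L ?R t) x = blinfun_apply (id_blinfun - circle_resolvent \<epsilon> B t) x"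
      using op_inv_right_apply[OF invertible, of t x]
      by (simp add: blinfun.diff_left circle_resolvent_def algebra_simps)
  qed
  have "B o\<^sub>L S = integral {0..1} (\<lambda>t. B o\<^sub>L ?R t)"
    unfolding S_def using integral_linear[OF int bounded_bilinear.bounded_linear_right[OF bounded_bilinear_blinfun_compose, of B]]
    by (simp add: o_def)
  also have "\<dots> = id_blinfun - riesz_proj \<epsilon> B"
    unfolding BR riesz_proj_eq_integral
    by (subst integral_diff) (auto intro: integrable_circle_resolvent)
  finally have BS: "B o\<^sub>L S = id_blinfun - riesz_proj \<epsilon> B" .
  moreover have "B o\<^sub>L S = S o\<^sub>L B"
    unfolding S_def by (rule integral_commute[OF int]) (auto intro!: blinfun_eqI simp: resolvent_commute)
  ultimately have SB: "S o\<^sub>L B = id_blinfun - riesz_proj \<epsilon> B" by simp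
  show "blinfun_apply B (blinfun_apply S x) = x - blinfun_apply (riesz_proj \<epsilon> B) x" for x
    using arg_cong[OF BS, of "\<lambda>S. blinfun_apply S x"] by (simp add: blinfun.diff_left)
  show "blinfun_apply S (blinfun_apply B x) = x - blinfun_apply (riesz_proj \<epsilon> B) x" for x
    using arg_cong[OF SB, of "\<lambda>S. blinfun_apply S x"] by (simp add: blinfun.diff_left)
qed

section \<open>Idempotence from means over equidistant nodes\<close>

text \<open>A Riemann sum for the Riesz projection whose nodes are the \<open>n\<close>-th roots of
  \<epsilon>^n exp (2 pi i \<theta>); \<theta> = 0 and \<theta> = 1/2 give interlaced sets.\<close>

definition circle_mean :: "nat \<Rightarrow> real \<Rightarrow> 'h \<Rightarrow>\<^sub>L 'h" where
  "circle_mean n \<theta> = (\<Sum>k<n. (1 / real n) *\<^sub>R circle_resolvent \<epsilon> B ((real k + \<theta>) / real n))"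

lemma circle_mean_apply:
  "blinfun_apply (circle_mean n \<theta>) x =
    (\<Sum>k<n. (1 / complex_of_nat n) *\<^sub>C blinfun_apply (circle_resolvent \<epsilon> B ((real k + \<theta>) / real n)) x)"
  by (simp add: circle_mean_def blinfun.sum_left blinfun.scaleR_left scaleR_scaleC)

text \<open>After raising to the power \<open>n\<close>, the index \<open>k\<close> contributes only
  full periods of the exponential.\<close>

lemma circlepath_node_power:
  assumes "n > 0"
  shows "circlepath 0 \<epsilon> ((real k + \<theta>) / real n) ^ n = of_real \<epsilon> ^ n * exp (2 * of_real pi * \<i> * of_real \<theta>)"
proof -
  have "exp (2 * of_real pi * \<i> * of_real ((real k + \<theta>) / real n)) ^ n
      = exp (of_nat n * (2 * of_real pi * \<i> * of_real ((real k + \<theta>) / real n)))"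
    by (rule exp_of_nat_mult[symmetric])
  also have "of_nat n * (2 * of_real pi * \<i> * of_real ((real k + \<theta>) / real n))
      = 2 * of_real pi * \<i> * of_real \<theta> + 2 * of_int (int k) * of_real pi * \<i>"
    using assms by (simp add: field_simps)
  also have "exp \<dots> = exp (2 * of_real pi * \<i> * of_real \<theta>)"
    using exp_integer_2pi[of "of_int (int k)"] by (simp add: exp_add mult_ac)
  finally show ?thesis by (simp add: circlepath power_mult_distrib)
qed

text \<open>The \<open>j\<close>-th powers of the nodes form a geometric progression with ratio
  \<open>w\<close>, an \<open>n\<close>-th root of unity; \<open>w\<close> differs from 1 because
  \<open>n\<close> does not divide \<open>j\<close>.\<close>

lemma circlepath_node_power_sum:
  assumes j: "0 < j" "j < n"
  shows "(\<Sum>k<n. inverse (circlepath 0 \<epsilon> ((real k + \<theta>) / real n)) ^ j) = 0"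
proof -
  define w where "w = exp (2 * of_real pi * \<i> * of_nat j / of_nat n)"
  define c where "c = of_real \<epsilon> ^ j * exp (of_nat j * (2 * of_real pi * \<i> * of_real (\<theta> / real n)))"
  have w: "w \<noteq> 1" "w ^ n = 1"
    using j complex_root_unity_eq_1[of n j] complex_root_unity[of n j] by (auto simp: w_def dest: dvd_imp_le)
  have node: "inverse (circlepath 0 \<epsilon> ((real k + \<theta>) / real n)) ^ j = inverse c * (inverse w) ^ k" for k
  proof -
    have "circlepath 0 \<epsilon> ((real k + \<theta>) / real n) ^ j
       = of_real \<epsilon> ^ j * exp (of_nat j * (2 * of_real pi * \<i> * of_real ((real k + \<theta>) / real n)))"
      by (simp only: circlepath power_mult_distrib exp_of_nat_mult add_0)
    also have "of_nat j * (2 * of_real pi * \<i> * of_real ((real k + \<theta>) / real n))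
       = of_nat j * (2 * of_real pi * \<i> * of_real (\<theta> / real n)) + of_nat k * (2 * of_real pi * \<i> * of_nat j / of_nat n)"
      using j by (simp add: field_simps)
    also have "exp \<dots> = exp (of_nat j * (2 * of_real pi * \<i> * of_real (\<theta> / real n))) * w ^ k"
      by (simp add: exp_add w_def flip: exp_of_nat_mult)
    finally have "circlepath 0 \<epsilon> ((real k + \<theta>) / real n) ^ j = c * w ^ k" by (simp add: c_def)
    then show ?thesis by (simp add: power_inverse)
  qed
  have "inverse w \<noteq> 1" "inverse w ^ n = 1" using w by (simp_all add: power_inverse)
  then have "(\<Sum>k<n. inverse w ^ k) = 0" by (simp add: sum_gp_strict)
  then show ?thesis by (simp add: node sum_distrib_left[symmetric])
qed

text \<open>This is the partial fraction identity
  \<open>1/n \<Sum>\<^sub>k 1 / (1 - b/\<zeta>\<^sub>k) = 1 / (1 - \<sigma> (b/\<epsilon>)\<^sup>n)\<close>, where \<open>\<zeta>\<^sub>k\<close> runs over the \<open>n\<close>-th roots of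
  \<open>\<epsilon>\<^sup>n/\<sigma>\<close>.\<close>

lemma circle_mean_left_inverse:
  assumes n: "n > 0" and s: "\<sigma> = inverse (exp (2 * of_real pi * \<i> * of_real \<theta>))"
  shows "blinfun_apply (circle_mean n \<theta>)
    (x - (\<sigma> * inverse (of_real \<epsilon> ^ n)) *\<^sub>C (blinfun_apply B ^^ n) x) = x"
proof -
  let ?t = "\<lambda>k. (real k + \<theta>) / real n" let ?\<alpha> = "\<lambda>k. inverse (circlepath 0 \<epsilon> (?t k))"
  have \<alpha>n: "\<sigma> * inverse (of_real \<epsilon> ^ n) = ?\<alpha> k ^ n" for k
    by (simp add: power_inverse circlepath_node_power[OF n] s)
  have "blinfun_apply (circle_mean n \<theta>) (x - (\<sigma> * inverse (of_real \<epsilon> ^ n)) *\<^sub>C (blinfun_apply B ^^ n) x)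
      = (\<Sum>k<n. (1 / complex_of_nat n) *\<^sub>C (\<Sum>j<n. (?\<alpha> k ^ j) *\<^sub>C (blinfun_apply B ^^ j) x))"
    unfolding circle_mean_apply
  proof (intro sum.cong refl arg_cong[where f = "scaleC _"])
    fix k
    show "blinfun_apply (circle_resolvent \<epsilon> B (?t k))
        (x - (\<sigma> * inverse (of_real \<epsilon> ^ n)) *\<^sub>C (blinfun_apply B ^^ n) x)
      = (\<Sum>j<n. (?\<alpha> k ^ j) *\<^sub>C (blinfun_apply B ^^ j) x)"
      unfolding \<alpha>n[of k] by (rule circle_resolvent_telescope)
  qed
  also have "\<dots> = (\<Sum>j<n. (1 / complex_of_nat n * (\<Sum>k<n. ?\<alpha> k ^ j)) *\<^sub>C (blinfun_apply B ^^ j) x)"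
    unfolding complex_vector.scale_sum_right
    by (subst sum.swap) (simp add: scaleC_scaleC sum_distrib_left complex_vector.scale_sum_left)
  \<comment> \<open>The power sums over the nodes vanish for 0 < j < n, so only the constant term of
    the geometric sums survives.\<close>
  also have "\<dots> = (\<Sum>j\<in>{0}. (1 / complex_of_nat n * (\<Sum>k<n. ?\<alpha> k ^ j)) *\<^sub>C (blinfun_apply B ^^ j) x)"
    using n circlepath_node_power_sum[of _ n \<theta>] by (intro sum.mono_neutral_right) auto
  also have "\<dots> = x" using n by simp
  finally show ?thesis .
qed

lemma circle_mean_commute:
  "blinfun_apply (circle_mean n \<theta>) (c *\<^sub>C (blinfun_apply B ^^ m) x)
    = c *\<^sub>C (blinfun_apply B ^^ m) (blinfun_apply (circle_mean n \<theta>) x)"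
proof -
  have comm: "blinfun_apply (circle_mean n \<theta>) (blinfun_apply B y)
      = blinfun_apply B (blinfun_apply (circle_mean n \<theta>) y)" for y
    by (simp add: circle_mean_apply circle_resolvent_commute blinfun.sum_right bounded_ops_scaleC[OF B])
  have "blinfun_apply (circle_mean n \<theta>) ((blinfun_apply B ^^ m) y)
      = (blinfun_apply B ^^ m) (blinfun_apply (circle_mean n \<theta>) y)" for y
    by (induction m) (simp_all add: comm)
  moreover have "blinfun_apply (circle_mean n \<theta>) (c *\<^sub>C y) = c *\<^sub>C blinfun_apply (circle_mean n \<theta>) y" for y
    by (simp add: circle_mean_apply bounded_ops_scaleC[OF circle_resolvent_bounded_ops]
        complex_vector.scale_sum_right scaleC_scaleC mult.commute)
  ultimately show ?thesis by simp
qed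

text \<open>With \<open>b = (B/\<epsilon>)\<^sup>n\<close> this is \<open>1/(1 - b) + 1/(1 + b) = 2/((1 - b)(1 + b))\<close>.\<close>

lemma circle_mean_product:
  assumes n: "n > 0"
  shows "circle_mean n 0 + circle_mean n (1/2) = 2 *\<^sub>R (circle_mean n 0 o\<^sub>L circle_mean n (1/2))"
proof (rule blinfun_eqI)
  fix x
  let ?X = "blinfun_apply (circle_mean n 0)" let ?Y = "blinfun_apply (circle_mean n (1/2))"
  define b where "b v = inverse (of_real \<epsilon> ^ n) *\<^sub>C (blinfun_apply B ^^ n) v" for v
  have X: "?X (v - b v) = v" for v
    using circle_mean_left_inverse[OF n, of 1 0 v] by (simp add: b_def)
  have "exp (2 * of_real pi * \<i> * of_real (1/2)) = (-1 :: complex)"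
    using exp_pi_i by (simp add: mult.commute)
  then have Y: "?Y (v + b v) = v" for v
    using circle_mean_left_inverse[OF n, of "-1" "1/2" v] by (simp add: b_def)
  define y where "y = ?Y x"
  have "?Y (b x) = b y" by (simp add: b_def y_def circle_mean_commute)
  then have "x = y + b y"
    using Y[of x] by (simp add: blinfun.add_right y_def)
  \<comment> \<open>Since x = y + b y, the arguments add up to 2 y; moreover \<open>?X\<close>
    undoes 1 - b, so the second summand is \<open>y\<close> itself.\<close>
  then have "?X x + ?X (y - b y) = ?X (2 *\<^sub>R y)"
    by (simp add: blinfun.add_right[symmetric] scaleR_2)
  then have "?X x + ?Y x = 2 *\<^sub>R ?X (?Y x)"
    by (simp only: X blinfun.scaleR_right) (simp add: y_def)
  then show "blinfun_apply (circle_mean n 0 + circle_mean n (1/2)) x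
      = blinfun_apply (2 *\<^sub>R (circle_mean n 0 o\<^sub>L circle_mean n (1/2))) x"
    by (simp add: blinfun.add_left blinfun.scaleR_left)
qed

text \<open>Both families of means tend to P, so \<open>circle_mean_product\<close> becomes 2 P = 2
  P^2 in the limit.\<close>

lemma riesz_proj_idem_compose: "riesz_proj \<epsilon> B o\<^sub>L riesz_proj \<epsilon> B = riesz_proj \<epsilon> B"
proof -
  let ?P = "riesz_proj \<epsilon> B"
  have lim: "(\<lambda>n. circle_mean n \<theta>) \<longlonglongrightarrow> ?P" if "0 \<le> \<theta>" "\<theta> \<le> 1" for \<theta>
    unfolding riesz_proj_eq_integral circle_mean_def
    using that by (intro riemann_sum_tendsto continuous_on_circle_resolvent)
  have "(\<lambda>n. circle_mean n 0 + circle_mean n (1/2)) \<longlonglongrightarrow> ?P + ?P"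
    by (intro tendsto_add lim) auto
  moreover have "(\<lambda>n. 2 *\<^sub>R (circle_mean n 0 o\<^sub>L circle_mean n (1/2))) \<longlonglongrightarrow> 2 *\<^sub>R (?P o\<^sub>L ?P)"
    by (intro tendsto_scaleR tendsto_const tendsto_blinfun_compose lim) auto
  then have "(\<lambda>n. circle_mean n 0 + circle_mean n (1/2)) \<longlonglongrightarrow> 2 *\<^sub>R (?P o\<^sub>L ?P)"
    by (rule Lim_transform_eventually)
      (use eventually_gt_at_top[of "0::nat"] in eventually_elim, simp add: circle_mean_product)
  ultimately have "2 *\<^sub>R (?P o\<^sub>L ?P) = ?P + ?P"
    using LIMSEQ_unique by blast
  then show ?thesis by (simp flip: scaleR_2)
qed

lemma riesz_proj_idem:
  "blinfun_apply (riesz_proj \<epsilon> B) (blinfun_apply (riesz_proj \<epsilon> B) x) = blinfun_apply (riesz_proj \<epsilon> B) x"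
  using arg_cong[OF riesz_proj_idem_compose, of "\<lambda>S. blinfun_apply S x"] by simp

end

section \<open>Matrices of operators in finite-dimensional subspaces\<close>

lemma cinner_span_eq_0:
  assumes "\<And>b. b \<in> B \<Longrightarrow> cinner b x = 0" and "v \<in> complex_vector.span B"
  shows "cinner v x = 0"
  using assms(2)
proof (induction rule: complex_vector.span_induct_alt)
  case (step c b v)
  then show ?case using assms(1) by (simp add: cinner_add_left cinner_scaleC_left)
qed simp

text \<open>Gram-Schmidt by induction. The vector \<open>x\<close> is generalised because the
  induction hypothesis is used for \<open>x\<close> and for the new vector \<open>b\<close>.\<close>

lemma finite_span_orthogonal_decomposition:
  fixes B :: "'h::complex_hilbert set"
  assumes "finite B"
  shows "\<exists>p\<in>complex_vector.span B. \<forall>b\<in>B. cinner b (x - p) = 0"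
  using assms
proof (induction B arbitrary: x)
  case (insert b B)
  obtain p where p: "p \<in> complex_vector.span B" "\<And>a. a \<in> B \<Longrightarrow> cinner a (x - p) = 0"
    using insert.IH[of x] by blast
  obtain q where q: "q \<in> complex_vector.span B" "\<And>a. a \<in> B \<Longrightarrow> cinner a (b - q) = 0"
    using insert.IH[of b] by blast
  define w where "w = b - q"
  \<comment> \<open>The projection is corrected along \<open>w\<close>, the component of
    \<open>b\<close> orthogonal to \<open>B\<close>. If \<open>b\<close> lies in the span of
    \<open>B\<close>, then w = 0 and the correction vanishes.\<close>
  define p' where "p' = p + (cinner w (x - p) / cinner w w) *\<^sub>C w"
  have p': "x - p' = (x - p) - (cinner w (x - p) / cinner w w) *\<^sub>C w" by (simp add: p'_def)
  have w: "cinner w (x - p') = 0"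
    by (cases "w = 0") (simp_all add: p' cinner_diff_right cinner_scaleC_right cinner_self_eq_0_iff)
  have B: "cinner a (x - p') = 0" if "a \<in> B" for a
    using p(2)[OF that] q(2)[OF that] unfolding p' w_def
    by (subst cinner_diff_right) (simp add: cinner_scaleC_right)
  have "cinner b (x - p') = cinner w (x - p') + cinner q (x - p')"
    by (simp add: w_def flip: cinner_add_left)
  also have "\<dots> = 0" using w cinner_span_eq_0[OF B q(1)] by simp
  finally have "cinner b (x - p') = 0" .
  moreover have "p \<in> complex_vector.span (insert b B)" "q \<in> complex_vector.span (insert b B)"
    using p(1) q(1) complex_vector.span_mono[of B "insert b B"] by blast+
  then have "p' \<in> complex_vector.span (insert b B)"
    unfolding p'_def w_def
    by (simp add: complex_vector.span_add complex_vector.span_scale complex_vector.span_diff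
        complex_vector.span_base)
  ultimately show ?case using B by blast
qed (auto intro: bexI[of _ 0])

text \<open>A dual basis turns coordinates into inner products, hence into bounded functionals that
  respect limits and integrals.\<close>

lemma representation_eq_cinner:
  fixes B :: "'h::complex_hilbert set"
  assumes fin: "finite B" and ind: "complex_vector.independent B"
  shows "\<exists>y. \<forall>v\<in>complex_vector.span B. \<forall>a\<in>B.
    complex_vector.representation B v a = cinner (y a) v"
proof -
  have "\<exists>y. \<forall>b\<in>B. cinner y b = (if b = a then 1 else 0)" if a: "a \<in> B" for a
  proof -
    obtain p where p: "p \<in> complex_vector.span (B - {a})" "\<And>b. b \<in> B - {a} \<Longrightarrow> cinner b (a - p) = 0"
      using finite_span_orthogonal_decomposition[of "B - {a}" a] fin by blast
    \<comment> \<open>The part of \<open>a\<close> orthogonal to the other basis vectors;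
      independence makes it nonzero.\<close>
    define y where "y = a - p"
    have "y \<noteq> 0" using ind a p(1) unfolding y_def complex_vector.dependent_def by auto
    then have yy: "cinner y y \<noteq> 0" by (simp add: cinner_self_eq_0_iff)
    have yb: "cinner y b = 0" if "b \<in> B - {a}" for b
      using p(2)[OF that] cinner_commute[of y b] by (simp add: y_def)
    have "cinner p y = 0" using cinner_span_eq_0[OF p(2) p(1)] by (simp add: y_def)
    then have "cinner y p = 0" using cinner_commute[of y p] by simp
    then have ya: "cinner y a = cinner y y"
      by (simp add: y_def cinner_diff_right)
    show ?thesis
      \<comment> \<open>The scalar normalises the product with \<open>a\<close> to 1; it is
        conjugated because the first argument of \<open>cinner\<close> is conjugate-linear.\<close>
      by (rule exI[of _ "cnj (inverse (cinner y y)) *\<^sub>C y"])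
        (use yy yb ya in \<open>auto simp: cinner_scaleC_left\<close>)
  qed
  then obtain y where y: "\<And>a b. a \<in> B \<Longrightarrow> b \<in> B \<Longrightarrow> cinner (y a) b = (if b = a then 1 else 0)"
    by metis
  show ?thesis
  proof (intro exI ballI)
    fix v a assume v: "v \<in> complex_vector.span B" and a: "a \<in> B"
    have "cinner (y a) v = cinner (y a) (\<Sum>b\<in>B. complex_vector.representation B v b *\<^sub>C b)"
      using complex_vector.sum_representation_eq[OF ind v fin] by simp
    also have "\<dots> = (\<Sum>b\<in>B. if b = a then complex_vector.representation B v b else 0)"
      by (auto simp: cinner_sum_right cinner_scaleC_right y a intro!: sum.cong)
    also have "\<dots> = complex_vector.representation B v a" using a fin by simp
    finally show "complex_vector.representation B v a = cinner (y a) v" ..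
  qed
qed

section \<open>Ordered bases, coordinates and matrices\<close>

text \<open>The predicate chosen from in \<open>det_on\<close>. The order of the list numbers the
  rows and columns, so that kernel vectors can be put first.\<close>

definition basis_list :: "'h::complex_hilbert list \<Rightarrow> 'h set \<Rightarrow> bool" where
  "basis_list bs V \<longleftrightarrow> distinct bs \<and> complex_vector.independent (set bs) \<and>
    complex_vector.span (set bs) = V"

abbreviation coord :: "'h::complex_hilbert list \<Rightarrow> 'h \<Rightarrow> nat \<Rightarrow> complex" where
  "coord bs v i \<equiv> complex_vector.representation (set bs) v (bs ! i)"

lemma basis_list_sum_nth:
  assumes "basis_list bs V"
  shows "(\<Sum>b\<in>set bs. f b) = (\<Sum>i<length bs. f (bs ! i))"
  using assms sum_list_distinct_conv_sum_set[of bs f]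
  by (simp add: basis_list_def sum_list_sum_nth atLeast0LessThan)

lemma basis_list_coord_sum:
  assumes "basis_list bs V" "v \<in> V"
  shows "(\<Sum>i<length bs. coord bs v i *\<^sub>C bs ! i) = v"
proof -
  have "(\<Sum>b\<in>set bs. complex_vector.representation (set bs) v b *\<^sub>C b) = v"
    using assms by (intro complex_vector.sum_representation_eq) (auto simp: basis_list_def)
  then show ?thesis by (simp only: basis_list_sum_nth[OF assms(1)])
qed

lemma basis_list_nth_in: "basis_list bs V \<Longrightarrow> i < length bs \<Longrightarrow> bs ! i \<in> V"
  by (auto simp: basis_list_def intro: complex_vector.span_base)

lemma basis_list_subspace: "basis_list bs V \<Longrightarrow> complex_vector.subspace V"
  by (auto simp: basis_list_def)

lemma coord_sum:
  assumes "basis_list bs V" "\<And>j. j \<in> J \<Longrightarrow> w j \<in> V"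
  shows "coord bs (\<Sum>j\<in>J. c j *\<^sub>C w j) i = (\<Sum>j\<in>J. c j * coord bs (w j) i)"
proof -
  have "coord bs (\<Sum>j\<in>J. c j *\<^sub>C w j) i = (\<Sum>j\<in>J. coord bs (c j *\<^sub>C w j) i)"
    using assms by (subst complex_vector.representation_sum)
      (auto simp: basis_list_def intro: complex_vector.span_scale)
  also have "\<dots> = (\<Sum>j\<in>J. c j * coord bs (w j) i)"
    using assms by (intro sum.cong refl)
      (auto simp: basis_list_def complex_vector.representation_scale)
  finally show ?thesis .
qed

lemma coord_nth:
  assumes "basis_list bs V" "i < length bs" "j < length bs"
  shows "coord bs (bs ! j) i = (if i = j then 1 else 0)"
  using assms complex_vector.representation_basis[of "set bs" "bs ! j"]
  by (auto simp: basis_list_def nth_eq_iff_index_eq)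

lemma coord_eq_0_iff:
  assumes "basis_list bs V" "v \<in> V"
  shows "(\<forall>i<length bs. coord bs v i = 0) \<longleftrightarrow> v = 0"
proof
  assume "\<forall>i<length bs. coord bs v i = 0"
  then have "(\<Sum>i<length bs. coord bs v i *\<^sub>C bs ! i) = 0" by simp
  then show "v = 0" using basis_list_coord_sum[OF assms] by simp
qed (simp add: complex_vector.representation_zero)

text \<open>Rows and columns have separate bases, so that the identity map yields change-of-basis
  matrices.\<close>

definition rep_mat ::
    "'h::complex_hilbert list \<Rightarrow> 'h list \<Rightarrow> ('h \<Rightarrow> 'h) \<Rightarrow> complex Matrix.mat" where
  "rep_mat bs cs f = Matrix.mat (length bs) (length cs) (\<lambda>(i, j). coord bs (f (cs ! j)) i)"

lemma rep_mat_carrier: "rep_mat bs cs f \<in> carrier_mat (length bs) (length cs)"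
  by (simp add: rep_mat_def)

lemma bounded_ops_linear: "T \<in> bounded_ops \<Longrightarrow> Vector_Spaces.linear scaleC scaleC (blinfun_apply T)"
  by unfold_locales (simp_all add: blinfun.add_right bounded_ops_scaleC
      scaleC_add_right scaleC_add_left scaleC_scaleC)

lemma linear_coord_sum:
  assumes "Vector_Spaces.linear scaleC scaleC f" "basis_list bs V" "v \<in> V"
  shows "f v = (\<Sum>i<length bs. coord bs v i *\<^sub>C f (bs ! i))"
proof -
  interpret f: Vector_Spaces.linear scaleC scaleC f by fact
  have "f v = f (\<Sum>i<length bs. coord bs v i *\<^sub>C bs ! i)"
    using basis_list_coord_sum[OF assms(2,3)] by simp
  then show ?thesis by (simp add: f.sum f.scale)
qed

lemma rep_mat_mult:
  assumes f: "Vector_Spaces.linear scaleC scaleC f"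
    and "as": "basis_list as U" and bs: "basis_list bs V" and cs: "basis_list cs W"
    and fV: "\<And>v. v \<in> V \<Longrightarrow> f v \<in> U" and gW: "\<And>v. v \<in> W \<Longrightarrow> g v \<in> V"
  shows "rep_mat as bs f * rep_mat bs cs g = rep_mat as cs (\<lambda>x. f (g x))"
proof (rule eq_matI)
  fix i j assume "i < dim_row (rep_mat as cs (\<lambda>x. f (g x)))" "j < dim_col (rep_mat as cs (\<lambda>x. f (g x)))"
  then have i: "i < length as" and j: "j < length cs" by (simp_all add: rep_mat_def)
  have gj: "g (cs ! j) \<in> V" using basis_list_nth_in[OF cs j] by (rule gW)
  have "coord as (f (g (cs ! j))) i
      = (\<Sum>k<length bs. coord bs (g (cs ! j)) k * coord as (f (bs ! k)) i)"
    by (subst linear_coord_sum[OF f bs gj], rule coord_sum[OF "as"])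
      (auto intro: fV basis_list_nth_in[OF bs])
  then show "(rep_mat as bs f * rep_mat bs cs g) $$ (i, j) = rep_mat as cs (\<lambda>x. f (g x)) $$ (i, j)"
    using i j by (simp add: rep_mat_def scalar_prod_def atLeast0LessThan mult.commute)
qed (simp_all add: rep_mat_def)

lemma rep_mat_id:
  assumes "basis_list bs V"
  shows "rep_mat bs bs (\<lambda>x. x) = 1\<^sub>m (length bs)"
  by (rule eq_matI) (simp_all add: rep_mat_def coord_nth[OF assms])

lemma basis_list_length:
  assumes "basis_list bs V"
  shows "length bs = complex_vector.dim V"
proof -
  have "complex_vector.dim V = card (set bs)"
    using assms unfolding basis_list_def
    by (intro complex_vector.dim_unique) (auto intro: complex_vector.span_base)
  then show ?thesis using assms by (simp add: basis_list_def distinct_card)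
qed

text \<open>Matrices of \<open>f\<close> in two bases are similar. This frees \<open>det_on\<close>
  from its arbitrarily chosen basis and permits one adapted to the kernel.\<close>

lemma det_on_eq_det_rep_mat:
  assumes f: "Vector_Spaces.linear scaleC scaleC f" and bs: "basis_list bs V"
    and fV: "\<And>v. v \<in> V \<Longrightarrow> f v \<in> V"
  shows "det_on V f = Determinant.det (rep_mat bs bs f)"
proof -
  define cs where "cs = (SOME bs. distinct bs \<and> complex_vector.independent (set bs) \<and>
                        complex_vector.span (set bs) = V)"
  have cs: "basis_list cs V"
    unfolding cs_def basis_list_def by (rule someI[of _ bs]) (use bs in \<open>simp add: basis_list_def\<close>)
  define n where "n = length bs"
  have len: "length cs = n" using basis_list_length[OF bs] basis_list_length[OF cs] by (simp add: n_def)
  have carr: "rep_mat xs ys g \<in> carrier_mat n n" if "xs \<in> {bs, cs}" "ys \<in> {bs, cs}" for xs ys g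
    using that rep_mat_carrier[of xs ys g] len by (auto simp: n_def)
  have id: "Vector_Spaces.linear scaleC scaleC (\<lambda>x::'a. x)"
    by unfold_locales (simp_all add: scaleC_add_right scaleC_add_left scaleC_scaleC)
  have "rep_mat cs bs (\<lambda>x. x) * rep_mat bs bs f * rep_mat bs cs (\<lambda>x. x) = rep_mat cs cs f"
    by (simp add: rep_mat_mult[OF id cs bs bs _ fV] rep_mat_mult[OF f cs bs cs] fV)
  then have "Determinant.det (rep_mat cs cs f)
      = Determinant.det (rep_mat cs bs (\<lambda>x. x)) * Determinant.det (rep_mat bs bs f)
        * Determinant.det (rep_mat bs cs (\<lambda>x. x))"
    using carr by (metis (no_types, lifting) Determinant.det_mult insertI1 insertI2 mult_carrier_mat)
  \<comment> \<open>The two change-of-basis matrices are inverse to each other, so their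
    determinants cancel.\<close>
  moreover have "rep_mat cs bs (\<lambda>x. x) * rep_mat bs cs (\<lambda>x. x) = 1\<^sub>m n"
    by (simp add: rep_mat_mult[OF id cs bs cs] rep_mat_id[OF cs] len)
  then have "Determinant.det (rep_mat cs bs (\<lambda>x. x)) * Determinant.det (rep_mat bs cs (\<lambda>x. x)) = 1"
    using carr by (metis Determinant.det_mult Determinant.det_one insertI1 insertI2)
  ultimately have "Determinant.det (rep_mat cs cs f) = Determinant.det (rep_mat bs bs f)"
    by (simp add: mult.commute mult.left_commute)
  then show ?thesis
    by (simp add: det_on_def rep_mat_def Let_def flip: cs_def)
qed

section \<open>Determinants: singularity, column factors, holomorphy\<close>

text \<open>Taking coordinates is injective on \<open>V\<close>, so the null vectors of the matrix
  are exactly the linear relations among the \<open>w j\<close>.\<close>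

lemma det_columns_eq_0_iff:
  assumes bs: "basis_list bs V" and w: "\<And>j. j < length bs \<Longrightarrow> w j \<in> V"
  shows "Determinant.det (Matrix.mat (length bs) (length bs) (\<lambda>(i, j). coord bs (w j) i)) = 0 \<longleftrightarrow>
    (\<exists>c. (\<exists>j<length bs. c j \<noteq> 0) \<and> (\<Sum>j<length bs. c j *\<^sub>C w j) = 0)"
proof -
  let ?n = "length bs" let ?M = "Matrix.mat ?n ?n (\<lambda>(i, j). coord bs (w j) i)"
  have prod: "?M *\<^sub>v Matrix.vec ?n c = 0\<^sub>v ?n \<longleftrightarrow> (\<Sum>j<?n. c j *\<^sub>C w j) = 0" for c
  proof -
    have "(\<Sum>j<?n. c j *\<^sub>C w j) \<in> V"
      using basis_list_subspace[OF bs] w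
      by (auto intro!: complex_vector.subspace_sum complex_vector.subspace_scale)
    then have "(\<Sum>j<?n. c j *\<^sub>C w j) = 0 \<longleftrightarrow> (\<forall>i<?n. (\<Sum>j<?n. c j * coord bs (w j) i) = 0)"
      using coord_sum[OF bs, of "{..<?n}" w c] w by (simp add: coord_eq_0_iff[OF bs, symmetric])
    also have "\<dots> \<longleftrightarrow> ?M *\<^sub>v Matrix.vec ?n c = 0\<^sub>v ?n"
      by (auto simp: vec_eq_iff scalar_prod_def atLeast0LessThan mult.commute)
    finally show ?thesis by simp
  qed
  have "Determinant.det ?M = 0 \<longleftrightarrow> (\<exists>v. v \<in> carrier_vec ?n \<and> v \<noteq> 0\<^sub>v ?n \<and> ?M *\<^sub>v v = 0\<^sub>v ?n)"
    by (rule det_0_iff_vec_prod_zero) simp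
  also have "\<dots> \<longleftrightarrow> (\<exists>c. Matrix.vec ?n c \<noteq> 0\<^sub>v ?n \<and> ?M *\<^sub>v Matrix.vec ?n c = 0\<^sub>v ?n)"
  proof safe
    fix v assume v: "v \<in> carrier_vec ?n" "v \<noteq> 0\<^sub>v ?n" "?M *\<^sub>v v = 0\<^sub>v ?n"
    have "Matrix.vec ?n (($) v) = v" using v(1) by auto
    then show "\<exists>c. Matrix.vec ?n c \<noteq> 0\<^sub>v ?n \<and> ?M *\<^sub>v Matrix.vec ?n c = 0\<^sub>v ?n"
      using v(2,3) by metis
  next
    fix c assume "Matrix.vec ?n c \<noteq> 0\<^sub>v ?n" "?M *\<^sub>v Matrix.vec ?n c = 0\<^sub>v ?n"
    then show "\<exists>v. v \<in> carrier_vec ?n \<and> v \<noteq> 0\<^sub>v ?n \<and> ?M *\<^sub>v v = 0\<^sub>v ?n"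
      by (intro exI[of _ "Matrix.vec ?n c"]) simp
  qed
  also have "\<dots> \<longleftrightarrow> (\<exists>c. (\<exists>j<?n. c j \<noteq> 0) \<and> (\<Sum>j<?n. c j *\<^sub>C w j) = 0)"
    unfolding prod by (auto simp: vec_eq_iff)
  finally show ?thesis .
qed

text \<open>Every Leibniz term visits each column once and so carries each factor \<open>d j\<close>
  once. No division occurs, so the factors may vanish.\<close>

lemma det_scale_columns:
  fixes h :: "nat \<Rightarrow> nat \<Rightarrow> 'a::comm_ring_1"
  shows "Determinant.det (Matrix.mat n n (\<lambda>(i, j). d j * h i j))
    = (\<Prod>j<n. d j) * Determinant.det (Matrix.mat n n (\<lambda>(i, j). h i j))"
proof -
  have "signof p * (\<Prod>i=0..<n. Matrix.mat n n (\<lambda>(i, j). d j * h i j) $$ (i, p i))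
      = (\<Prod>j<n. d j) * (signof p * (\<Prod>i=0..<n. Matrix.mat n n (\<lambda>(i, j). h i j) $$ (i, p i)))"
    if "p permutes {0..<n}" for p
  proof -
    have "p i < n" if "i < n" for i
      using permutes_in_image[OF \<open>p permutes _\<close>, of i] that by simp
    then have "(\<Prod>i=0..<n. Matrix.mat n n (\<lambda>(i, j). d j * h i j) $$ (i, p i))
        = (\<Prod>i=0..<n. d (p i)) * (\<Prod>i=0..<n. Matrix.mat n n (\<lambda>(i, j). h i j) $$ (i, p i))"
      by (simp add: prod.distrib)
    moreover have "(\<Prod>i=0..<n. d (p i)) = (\<Prod>j<n. d j)"
      using prod.permute[OF that, of d] by (simp add: o_def atLeast0LessThan)
    ultimately show ?thesis by (simp add: mult_ac)
  qed
  then have "(\<Sum>p\<in>{p. p permutes {0..<n}}. signof p * (\<Prod>i=0..<n. Matrix.mat n n (\<lambda>(i, j). d j * h i j) $$ (i, p i)))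
      = (\<Prod>j<n. d j) * (\<Sum>p\<in>{p. p permutes {0..<n}}. signof p * (\<Prod>i=0..<n. Matrix.mat n n (\<lambda>(i, j). h i j) $$ (i, p i)))"
    unfolding sum_distrib_left by (intro sum.cong refl) auto
  then show ?thesis by (simp only: Determinant.det_def'[OF mat_carrier])
qed

lemma holomorphic_on_det:
  assumes "\<And>i j. i < n \<Longrightarrow> j < n \<Longrightarrow> h i j holomorphic_on S"
  shows "(\<lambda>z. Determinant.det (Matrix.mat n n (\<lambda>(i, j). h i j z))) holomorphic_on S"
proof -
  have "(\<lambda>z. \<Sum>p\<in>{p. p permutes {0..<n}}. signof p * (\<Prod>i=0..<n. h i (p i) z)) holomorphic_on S"
    by (intro holomorphic_intros assms) (auto dest: permutes_in_image)
  moreover have "Determinant.det (Matrix.mat n n (\<lambda>(i, j). h i j z))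
      = (\<Sum>p\<in>{p. p permutes {0..<n}}. signof p * (\<Prod>i=0..<n. h i (p i) z))" for z
    by (subst Determinant.det_def'[of _ n]) (auto intro!: sum.cong prod.cong dest: permutes_in_image)
  ultimately show ?thesis by simp
qed

text \<open>Serves to put a basis of the kernel in the first places of a basis of ran P(z0).\<close>

lemma basis_list_extend:
  fixes K V :: "'h::complex_hilbert set"
  assumes V: "complex_vector.subspace V" "cfinite_dim V" and K: "complex_vector.subspace K" "K \<subseteq> V"
  obtains ks cs where "basis_list ks K" "basis_list (ks @ cs) V"
proof -
  obtain D where D: "finite D" "V \<subseteq> complex_vector.span D" using V by (auto simp: cfinite_dim_def)
  obtain B where B: "B \<subseteq> K" "complex_vector.independent B" "K \<subseteq> complex_vector.span B"
    using complex_vector.maximal_independent_subset by metis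
  obtain C where C: "B \<subseteq> C" "C \<subseteq> V" "complex_vector.independent C" "V \<subseteq> complex_vector.span C"
    using complex_vector.maximal_independent_subset_extend[of B V] B K by (metis subset_trans)
  have finC: "finite C"
    using complex_vector.independent_span_bound[OF D(1) C(3)] C D by auto
  then have finB: "finite B" using C finite_subset by blast
  obtain ks where ks: "set ks = B" "distinct ks" using finite_distinct_list[OF finB] by blast
  obtain cs where cs: "set cs = C - B" "distinct cs"
    using finite_distinct_list[of "C - B"] finC by blast
  have "complex_vector.span B = K"
    using B K complex_vector.span_minimal by blast
  then have "basis_list ks K" using ks B by (simp add: basis_list_def)
  moreover have "complex_vector.span C = V"
    using C V complex_vector.span_minimal by blast
  moreover have "set (ks @ cs) = C" using ks cs C by auto
  ultimately show ?thesis
    using that[of ks cs] ks cs C by (auto simp: basis_list_def)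
qed

text \<open>As \<open>h\<close> does not vanish identically on the connected set \<open>S\<close>,
  it has a finite order at \<open>z0\<close>, which adds to \<open>m\<close>; the sum equals
  \<open>m\<close> exactly if that order is 0. Values of \<open>f\<close> off \<open>z0\<close>
  determine \<open>zorder\<close>.\<close>

lemma zorder_power_times_eq_iff:
  assumes S: "open S" "connected S" "z0 \<in> S" and h: "h holomorphic_on S" "\<exists>w\<in>S. h w \<noteq> 0"
    and f: "\<And>w. w \<in> S \<Longrightarrow> w \<noteq> z0 \<Longrightarrow> f w = (w - z0) ^ m * h w"
  shows "nat (zorder f z0) = m \<longleftrightarrow> h z0 \<noteq> 0"
proof -
  define n where "n = zorder h z0"
  define g where "g = zor_poly h z0"
  obtain r where n: "if h z0 = 0 then n > 0 else n = 0" and r: "r > 0" "cball z0 r \<subseteq> S"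
    and g: "g holomorphic_on cball z0 r"
      "\<And>w. w \<in> cball z0 r \<Longrightarrow> h w = g w * (w - z0) ^ nat n \<and> g w \<noteq> 0"
    using zorder_exist_zero[OF h(1) S h(2)] unfolding n_def g_def by blast
  have "zorder f z0 = int m + n"
  proof (rule zorder_eqI[of "ball z0 r" z0 g])
    show "f w = g w * (w - z0) powi (int m + n)" if "w \<in> ball z0 r" "w \<noteq> z0" for w
    proof -
      have "(w - z0) powi (int m + n) = (w - z0) ^ m * (w - z0) ^ nat n"
        using that n by (simp add: power_int_def nat_add_distrib power_add split: if_splits)
      moreover have "w \<in> cball z0 r" using that by simp
      ultimately show ?thesis using f[of w] g(2)[of w] r(2) that(2) by auto
    qed
  qed (use r g in \<open>auto intro: holomorphic_on_subset\<close>)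
  then show ?thesis using n by (auto split: if_splits)
qed

section \<open>Poles of the inverse\<close>

text \<open>Convergence at a single point at distance r/2 bounds the coefficients; within distance
  r/4 the remainder is then dominated by a geometric series of ratio 1/2.\<close>

lemma op_power_series_tendsto:
  fixes C :: "nat \<Rightarrow> 'h::complex_hilbert \<Rightarrow>\<^sub>L 'h"
  assumes r: "r > 0" and sums: "\<And>w. w \<in> ball z0 r - {z0} \<Longrightarrow>
    (\<lambda>k. scalar_op ((w - z0) ^ k) o\<^sub>L C k) sums B w"
  shows "(B \<longlongrightarrow> C 0) (at z0)"
proof -
  have "(\<lambda>k. scalar_op ((z0 + of_real (r/2) - z0) ^ k) o\<^sub>L C k) sums B (z0 + of_real (r/2))"
    using r by (intro sums) (auto simp: dist_norm)
  then have "(\<lambda>k. scalar_op ((z0 + of_real (r/2) - z0) ^ k) o\<^sub>L C k) \<longlonglongrightarrow> 0"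
    by (intro summable_LIMSEQ_zero sums_summable)
  then have "Bseq (\<lambda>k. scalar_op ((z0 + of_real (r/2) - z0) ^ k) o\<^sub>L C k)"
    by (intro convergent_imp_Bseq convergentI)
  then obtain K where K: "K > 0" "\<And>k. norm (scalar_op ((z0 + of_real (r/2) - z0) ^ k) o\<^sub>L C k) \<le> K"
    unfolding Bseq_def by blast
  have CK: "(r/2) ^ k * norm (C k) \<le> K" for k
  proof -
    have "norm (z0 + of_real (r/2) - z0) = r/2"
      using r by (simp only: add_diff_cancel_left' norm_of_real)
    then show ?thesis using K(2)[of k] by (simp only: norm_scalar_op_compose norm_power)
  qed
  have bound: "norm (B w - C 0) \<le> norm (w - z0) * (4 * K / r)"
    if w: "w \<noteq> z0" "norm (w - z0) < r/4" for w
  proof -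
    define f where "f k = scalar_op ((w - z0) ^ Suc k) o\<^sub>L C (Suc k)" for k
    have "w \<in> ball z0 r - {z0}" using w r by (auto simp: dist_norm norm_minus_commute)
    moreover have "scalar_op ((w - z0) ^ 0) o\<^sub>L C 0 = C 0" by (rule blinfun_eqI) simp
    ultimately have f: "f sums (B w - C 0)"
      using sums_split_initial_segment[OF sums, of w 1] unfolding f_def by simp
    have le: "norm (f k) \<le> norm (w - z0) * (2 * K / r) * (1/2) ^ k" for k
    proof -
      have "norm (f k) = norm (w - z0) * (norm (w - z0) ^ k * norm (C (Suc k)))"
        by (simp add: f_def norm_scalar_op_compose norm_power norm_mult mult.assoc)
      also have "\<dots> \<le> norm (w - z0) * ((r/4) ^ k * norm (C (Suc k)))"
        using w r by (intro mult_left_mono mult_right_mono power_mono) auto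
      \<comment> \<open>Regrouping to apply the bound on (r/2)^(k+1) * norm (C (k+1)); the
        additional factor r/2 is compensated by 2/r.\<close>
      also have "(r/4) ^ k * norm (C (Suc k)) = (1/2) ^ k * (2/r) * ((r/2) ^ Suc k * norm (C (Suc k)))"
      proof -
        have "(r/4) ^ k = (1/2) ^ k * (r/2) ^ k" by (simp only: power_mult_distrib[symmetric]) simp
        then show ?thesis using r by (simp only: power_Suc) simp
      qed
      also have "norm (w - z0) * \<dots> \<le> norm (w - z0) * ((1/2) ^ k * (2/r) * K)"
        using CK[of "Suc k"] r by (intro mult_left_mono) auto
      finally show ?thesis by (simp add: mult_ac)
    qed
    have geo: "(\<lambda>k. norm (w - z0) * (2 * K / r) * (1/2) ^ k) sums (norm (w - z0) * (2 * K / r) * 2)"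
      using sums_mult[OF geometric_sums[of "1/2::real"], of "norm (w - z0) * (2 * K / r)"] by simp
    have "norm (suminf f) \<le> (\<Sum>k. norm (w - z0) * (2 * K / r) * (1/2) ^ k)"
      by (rule norm_suminf_le[OF le sums_summable[OF geo]])
    also have "\<dots> = norm (w - z0) * (4 * K / r)"
      unfolding sums_unique[OF geo, symmetric] by (simp add: mult_ac)
    finally show ?thesis using sums_unique[OF f] by simp
  qed
  have "((\<lambda>w. B w - C 0) \<longlongrightarrow> 0) (at z0)"
  proof (rule Lim_null_comparison)
    show "\<forall>\<^sub>F w in at z0. norm (B w - C 0) \<le> norm (w - z0) * (4 * K / r)"
      unfolding eventually_at by (rule exI[of _ "r/4"]) (use r bound in \<open>auto simp: dist_norm\<close>)
    have "((\<lambda>w. norm (w - z0) * (4 * K / r)) \<longlongrightarrow> norm (z0 - z0) * (4 * K / r)) (at z0)"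
      by (intro tendsto_intros)
    then show "((\<lambda>w. norm (w - z0) * (4 * K / r)) \<longlongrightarrow> 0) (at z0)" by simp
  qed
  then show ?thesis by (rule LIM_zero_cancel)
qed

text \<open>Only the two leading Laurent coefficients matter. Presenting them as limits turns the
  comparison of coefficients into uniqueness of limits; both come from
  \<open>op_power_series_tendsto\<close>, the second for the shifted series.\<close>

lemma inverse_pole_order_limits:
  fixes A :: "complex \<Rightarrow> 'h::complex_hilbert \<Rightarrow>\<^sub>L 'h"
  assumes "inverse_pole_order A z0 n"
  defines "B \<equiv> \<lambda>w. scalar_op ((w - z0) ^ n) o\<^sub>L op_inv (A w)"
  obtains C0 C1 where "C0 \<noteq> 0" "(B \<longlongrightarrow> C0) (at z0)"
    "((\<lambda>w. scalar_op (inverse (w - z0)) o\<^sub>L (B w - C0)) \<longlongrightarrow> C1) (at z0)"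
    "\<forall>\<^sub>F w in at z0. boundedly_invertible (A w)"
proof -
  from assms(1) obtain r C where r: "r > 0" and C: "C 0 \<noteq> 0" and
    inv: "\<And>w. w \<in> ball z0 r - {z0} \<Longrightarrow> boundedly_invertible (A w)" and
    sums: "\<And>w. w \<in> ball z0 r - {z0} \<Longrightarrow>
      (\<lambda>k. scalar_op ((w - z0) powi (int k - int n)) o\<^sub>L C k) sums op_inv (A w)"
    unfolding inverse_pole_order_def by blast
  have B: "(\<lambda>k. scalar_op ((w - z0) ^ k) o\<^sub>L C k) sums B w" if w: "w \<in> ball z0 r - {z0}" for w
  proof -
    have "scalar_op ((w - z0) ^ n) o\<^sub>L (scalar_op ((w - z0) powi (int k - int n)) o\<^sub>L C k)
        = scalar_op ((w - z0) ^ k) o\<^sub>L C k" for k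
    proof -
      have "(w - z0) ^ n * (w - z0) powi (int k - int n) = (w - z0) ^ k"
        using w by (simp add: power_int_diff)
      then show ?thesis by (intro blinfun_eqI) (simp add: scaleC_scaleC)
    qed
    then show ?thesis
      using bounded_linear.sums[OF bounded_bilinear.bounded_linear_right[OF bounded_bilinear_blinfun_compose]
          sums[OF w], of "scalar_op ((w - z0) ^ n)"] by (simp add: B_def)
  qed
  have B1: "(\<lambda>k. scalar_op ((w - z0) ^ k) o\<^sub>L C (Suc k)) sums
      (scalar_op (inverse (w - z0)) o\<^sub>L (B w - C 0))" if w: "w \<in> ball z0 r - {z0}" for w
  proof -
    have "scalar_op ((w - z0) ^ 0) o\<^sub>L C 0 = C 0" by (rule blinfun_eqI) simp
    then have "(\<lambda>k. scalar_op ((w - z0) ^ Suc k) o\<^sub>L C (Suc k)) sums (B w - C 0)"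
      using sums_split_initial_segment[OF B[OF w], of 1] by simp
    from bounded_linear.sums[OF bounded_bilinear.bounded_linear_right[OF bounded_bilinear_blinfun_compose]
          this, of "scalar_op (inverse (w - z0))"]
    have "(\<lambda>k. scalar_op (inverse (w - z0)) o\<^sub>L (scalar_op ((w - z0) ^ Suc k) o\<^sub>L C (Suc k))) sums
      (scalar_op (inverse (w - z0)) o\<^sub>L (B w - C 0))" .
    moreover have "scalar_op (inverse (w - z0)) o\<^sub>L (scalar_op ((w - z0) ^ Suc k) o\<^sub>L C (Suc k))
        = scalar_op ((w - z0) ^ k) o\<^sub>L C (Suc k)" for k
      using w by (intro blinfun_eqI) (simp add: scaleC_scaleC)
    ultimately show ?thesis by simp
  qed
  have "\<forall>\<^sub>F w in at z0. boundedly_invertible (A w)"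
    unfolding eventually_at by (rule exI[of _ r]) (use r inv in \<open>auto simp: dist_commute\<close>)
  with C op_power_series_tendsto[OF r B] op_power_series_tendsto[of r z0 "\<lambda>k. C (Suc k)", OF r B1]
  show ?thesis by (rule that)
qed

lemma op_analytic_on_tendsto:
  assumes D: "((\<lambda>w. scalar_op (inverse (w - z)) o\<^sub>L (A w - A z)) \<longlongrightarrow> D) (at z)"
  shows "(A \<longlongrightarrow> A z) (at z)"
proof -
  have "((\<lambda>w. scalar_op (w - z) o\<^sub>L (scalar_op (inverse (w - z)) o\<^sub>L (A w - A z))) \<longlongrightarrow>
      (scalar_op (z - z) o\<^sub>L D)) (at z)"
    by (intro tendsto_blinfun_compose tendsto_scalar_op D tendsto_intros)
  moreover have "\<forall>\<^sub>F w in at z. scalar_op (w - z) o\<^sub>L (scalar_op (inverse (w - z)) o\<^sub>L (A w - A z)) = A w - A z"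
    unfolding eventually_at
    by (rule exI[of _ 1]) (auto intro!: blinfun_eqI simp: scaleC_scaleC)
  ultimately have "((\<lambda>w. A w - A z) \<longlongrightarrow> (scalar_op (z - z) o\<^sub>L D)) (at z)"
    by (rule Lim_transform_eventually)
  then have "((\<lambda>w. A w - A z) \<longlongrightarrow> 0) (at z)" by simp
  then show ?thesis by (rule LIM_zero_cancel)
qed

text \<open>\<open>A(z)\<inverse> = (z - z\<^sub>0)\<^bsup>-n\<^esup> (C\<^sub>0 + (z - z\<^sub>0) C\<^sub>1 + \<dots>)\<close>. If \<open>n = 1\<close>, comparing coefficients in
  \<open>A(z)\<inverse> A(z) = I\<close> gives \<open>C\<^sub>0 A(z\<^sub>0) = 0\<close> and \<open>C\<^sub>0 A'(z\<^sub>0) = I\<close> on \<open>ker A(z\<^sub>0)\<close>. If \<open>n \<ge> 2\<close>,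
  comparing them in \<open>A(z) A(z)\<inverse> = I\<close> gives \<open>A(z\<^sub>0) C\<^sub>0 = 0\<close> and
  \<open>A'(z\<^sub>0) C\<^sub>0 + A(z\<^sub>0) C\<^sub>1 = 0\<close>.\<close>

lemma simple_pole_iff:
  fixes A :: "complex \<Rightarrow> 'h::complex_hilbert \<Rightarrow>\<^sub>L 'h"
  assumes lin: "\<forall>\<^sub>F w in at z0. A w \<in> bounded_ops" "A z0 \<in> bounded_ops"
    and D: "((\<lambda>w. scalar_op (inverse (w - z0)) o\<^sub>L (A w - A z0)) \<longlongrightarrow> D) (at z0)"
    and pole: "inverse_has_pole A z0"
  shows "inverse_has_simple_pole A z0 \<longleftrightarrow>
    (\<forall>u x. blinfun_apply (A z0) u = 0 \<longrightarrow> blinfun_apply D u = blinfun_apply (A z0) x \<longrightarrow> u = 0)"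
proof
  let ?q = "\<lambda>w. scalar_op (inverse (w - z0)) o\<^sub>L (A w - A z0)"
  have A: "(A \<longlongrightarrow> A z0) (at z0)" using D by (rule op_analytic_on_tendsto)
  have ne: "\<forall>\<^sub>F w in at z0. w \<noteq> z0" by (rule eventually_neq_at_within)
  {
    assume "inverse_has_simple_pole A z0"
    then have "inverse_pole_order A z0 1" by (simp add: inverse_has_simple_pole_def)
    then obtain C0 where C0: "((\<lambda>w. scalar_op ((w - z0) ^ 1) o\<^sub>L op_inv (A w)) \<longlongrightarrow> C0) (at z0)"
      and inv: "\<forall>\<^sub>F w in at z0. boundedly_invertible (A w)"
      by (rule inverse_pole_order_limits)
    let ?B = "\<lambda>w. scalar_op ((w - z0) ^ 1) o\<^sub>L op_inv (A w)"
    show "\<forall>u x. blinfun_apply (A z0) u = 0 \<longrightarrow> blinfun_apply D u = blinfun_apply (A z0) x \<longrightarrow> u = 0"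
    proof (intro allI impI)
      fix u x assume u: "blinfun_apply (A z0) u = 0" and x: "blinfun_apply D u = blinfun_apply (A z0) x"
      \<comment> \<open>B(w) A(w) = (w - z0) I tends to 0, whence C0 A(z0) = 0.\<close>
      have "((\<lambda>w. blinfun_apply (?B w) (blinfun_apply (A w) x)) \<longlongrightarrow>
          blinfun_apply C0 (blinfun_apply (A z0) x)) (at z0)"
        by (intro blinfun.tendsto C0 A tendsto_const)
      moreover have "((\<lambda>w. blinfun_apply (?B w) (blinfun_apply (A w) x)) \<longlongrightarrow> 0) (at z0)"
      proof (rule Lim_transform_eventually)
        show "((\<lambda>w. (w - z0) *\<^sub>C x) \<longlongrightarrow> 0) (at z0)"
          using scaleC_tendsto[of "\<lambda>w. w - z0" 0 "at z0" "\<lambda>_. x" x] by (simp add: LIM_zero)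
        show "\<forall>\<^sub>F w in at z0. (w - z0) *\<^sub>C x = blinfun_apply (?B w) (blinfun_apply (A w) x)"
          using inv by eventually_elim (simp add: op_inv_left_apply)
      qed
      ultimately have C0A: "blinfun_apply C0 (blinfun_apply (A z0) x) = 0"
        using tendsto_unique[OF at_neq_bot] by blast
      \<comment> \<open>As \<open>u\<close> is in the kernel, the difference quotient applied to it
        is A(w) u / (w - z0), which B(w) maps back to \<open>u\<close>.\<close>
      have "((\<lambda>w. blinfun_apply (?B w) (blinfun_apply (?q w) u)) \<longlongrightarrow>
          blinfun_apply C0 (blinfun_apply D u)) (at z0)"
        by (intro blinfun.tendsto C0 D tendsto_const)
      moreover have "((\<lambda>w. blinfun_apply (?B w) (blinfun_apply (?q w) u)) \<longlongrightarrow> u) (at z0)"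
      proof (rule Lim_transform_eventually[OF tendsto_const])
        show "\<forall>\<^sub>F w in at z0. u = blinfun_apply (?B w) (blinfun_apply (?q w) u)"
          using inv ne
          by eventually_elim (simp add: u op_inv_left_apply blinfun.diff_left scaleC_scaleC
              bounded_ops_scaleC[OF op_inv_bounded_ops])
      qed
      ultimately have "blinfun_apply C0 (blinfun_apply D u) = u"
        using tendsto_unique[OF at_neq_bot] by blast
      with C0A x show "u = 0" by simp
    qed
  }
  assume star: "\<forall>u x. blinfun_apply (A z0) u = 0 \<longrightarrow> blinfun_apply D u = blinfun_apply (A z0) x \<longrightarrow> u = 0"
  obtain n where n: "inverse_pole_order A z0 n" using pole by (auto simp: inverse_has_pole_def)
  let ?B = "\<lambda>w. scalar_op ((w - z0) ^ n) o\<^sub>L op_inv (A w)"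
  show "inverse_has_simple_pole A z0"
  proof (rule ccontr)
    assume "\<not> inverse_has_simple_pole A z0"
    then have "n \<noteq> 1" using n by (auto simp: inverse_has_simple_pole_def)
    moreover have "n \<ge> 1" using n by (simp add: inverse_pole_order_def)
    \<comment> \<open>Makes visible that n and n - 1 are both positive exponents, so the
      corresponding powers of w - z0 tend to 0.\<close>
    ultimately have n2: "n = Suc (Suc (n - 2))" by simp
    from n obtain C0 C1 where C0: "C0 \<noteq> 0" "(?B \<longlongrightarrow> C0) (at z0)"
      and C1: "((\<lambda>w. scalar_op (inverse (w - z0)) o\<^sub>L (?B w - C0)) \<longlongrightarrow> C1) (at z0)"
      and inv: "\<forall>\<^sub>F w in at z0. boundedly_invertible (A w)"
      by (rule inverse_pole_order_limits)
    have AB: "\<forall>\<^sub>F w in at z0. blinfun_apply (A w) (blinfun_apply (?B w) x) = ((w - z0) ^ n) *\<^sub>C x" for x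
      using inv lin(1) by eventually_elim (simp add: op_inv_right_apply bounded_ops_scaleC)
    \<comment> \<open>The vector C0 x will violate \<open>star\<close>: it is a nonzero kernel
      vector that D maps to - A(z0) C1 x.\<close>
    obtain x where x: "blinfun_apply C0 x \<noteq> 0" using C0(1) by (metis blinfun_eqI zero_blinfun.rep_eq)
    have zero: "((\<lambda>w. ((w - z0) ^ Suc k) *\<^sub>C x) \<longlongrightarrow> 0) (at z0)" for k
    proof -
      have "((\<lambda>w. ((w - z0) ^ Suc k) *\<^sub>C x) \<longlongrightarrow> ((z0 - z0) ^ Suc k) *\<^sub>C x) (at z0)"
        by (intro scaleC_tendsto tendsto_intros)
      then show ?thesis by simp
    qed
    have "((\<lambda>w. blinfun_apply (A w) (blinfun_apply (?B w) x)) \<longlongrightarrow>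
        blinfun_apply (A z0) (blinfun_apply C0 x)) (at z0)"
      by (intro blinfun.tendsto C0 A tendsto_const)
    moreover have "((\<lambda>w. blinfun_apply (A w) (blinfun_apply (?B w) x)) \<longlongrightarrow> 0) (at z0)"
    proof (rule Lim_transform_eventually)
      show "((\<lambda>w. ((w - z0) ^ n) *\<^sub>C x) \<longlongrightarrow> 0) (at z0)"
        by (subst n2) (rule zero)
      show "\<forall>\<^sub>F w in at z0. ((w - z0) ^ n) *\<^sub>C x = blinfun_apply (A w) (blinfun_apply (?B w) x)"
        using AB[of x] by eventually_elim (rule sym)
    qed
    ultimately have AC0: "blinfun_apply (A z0) (blinfun_apply C0 x) = 0"
      using tendsto_unique[OF at_neq_bot] by blast
    \<comment> \<open>The terms A(z0) B(w) x cancel and A(z0) C0 x = 0, so the sum is A(w) B(w) x /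
      (w - z0) = (w - z0)^(n-1) x off \<open>z0\<close>.\<close>
    have "((\<lambda>w. blinfun_apply (?q w) (blinfun_apply (?B w) x) +
          blinfun_apply (A z0) (blinfun_apply (scalar_op (inverse (w - z0)) o\<^sub>L (?B w - C0)) x)) \<longlongrightarrow>
        blinfun_apply D (blinfun_apply C0 x) + blinfun_apply (A z0) (blinfun_apply C1 x)) (at z0)"
      by (intro tendsto_add blinfun.tendsto C0 C1 D tendsto_const)
    moreover have "((\<lambda>w. blinfun_apply (?q w) (blinfun_apply (?B w) x) +
          blinfun_apply (A z0) (blinfun_apply (scalar_op (inverse (w - z0)) o\<^sub>L (?B w - C0)) x)) \<longlongrightarrow> 0) (at z0)"
    proof (rule Lim_transform_eventually)
      show "((\<lambda>w. ((w - z0) ^ Suc (n - 2)) *\<^sub>C x) \<longlongrightarrow> 0) (at z0)"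
        by (rule zero)
      show "\<forall>\<^sub>F w in at z0. ((w - z0) ^ Suc (n - 2)) *\<^sub>C x = blinfun_apply (?q w) (blinfun_apply (?B w) x) +
          blinfun_apply (A z0) (blinfun_apply (scalar_op (inverse (w - z0)) o\<^sub>L (?B w - C0)) x)"
        using AB[of x] ne
      proof eventually_elim
        case (elim w)
        define b where "b = blinfun_apply (?B w) x"
        have pw: "inverse (w - z0) * (w - z0) ^ n = (w - z0) ^ Suc (n - 2)"
          by (subst n2) (use elim(2) in simp)
        have "blinfun_apply (?q w) b +
            blinfun_apply (A z0) (blinfun_apply (scalar_op (inverse (w - z0)) o\<^sub>L (?B w - C0)) x)
          = inverse (w - z0) *\<^sub>C (blinfun_apply (A w) b - blinfun_apply (A z0) b
             + (blinfun_apply (A z0) b - blinfun_apply (A z0) (blinfun_apply C0 x)))"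
          unfolding b_def
          by (simp only: blinfun_apply_blinfun_compose scalar_op_apply blinfun.diff_left blinfun.diff_right
              bounded_ops_scaleC[OF lin(2)] scaleC_add_right
              complex_vector.scale_right_diff_distrib)
        also have "\<dots> = inverse (w - z0) *\<^sub>C ((w - z0) ^ n) *\<^sub>C x"
          using elim(1) by (simp add: AC0 b_def)
        finally show ?case by (simp add: b_def scaleC_scaleC pw)
      qed
    qed
    ultimately have "blinfun_apply D (blinfun_apply C0 x) + blinfun_apply (A z0) (blinfun_apply C1 x) = 0"
      using tendsto_unique[OF at_neq_bot] by blast
    then have "blinfun_apply D (blinfun_apply C0 x) = blinfun_apply (A z0) (- blinfun_apply C1 x)"
      by (simp add: blinfun.minus_right eq_neg_iff_add_eq_0)
    with star AC0 x show False by blast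
  qed
qed

section \<open>Holomorphy of parameter integrals\<close>

text \<open>Riemann sums in \<open>t\<close> are holomorphic in \<open>z\<close>. By uniform
  continuity on a closed disc times [0,1] they converge uniformly there, so the limit is
  holomorphic.\<close>

lemma holomorphic_on_integral:
  fixes f :: "complex \<Rightarrow> real \<Rightarrow> complex"
  assumes S: "open S" and cont: "continuous_on (S \<times> {0..1}) (\<lambda>(z, t). f z t)"
    and hol: "\<And>t. t \<in> {0..1} \<Longrightarrow> (\<lambda>z. f z t) holomorphic_on S"
  shows "(\<lambda>z. integral {0..1} (f z)) holomorphic_on S"
proof (rule holomorphic_uniform_sequence[OF S])
  let ?F = "\<lambda>n z. \<Sum>k<n. (1 / real n) *\<^sub>R f z (real k / real n)"
  show "?F n holomorphic_on S" for n
    unfolding scaleR_conv_of_real by (intro holomorphic_intros hol) (auto simp: divide_simps)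
  fix x assume x: "x \<in> S"
  then obtain d where d: "d > 0" "cball x d \<subseteq> S" using S open_contains_cball by blast
  have contK: "continuous_on (cball x d \<times> {0..1}) (\<lambda>(z, t). f z t)"
    by (rule continuous_on_subset[OF cont]) (use d in auto)
  have uc: "uniformly_continuous_on (cball x d \<times> {0..1}) (\<lambda>(z, t). f z t)"
    by (rule compact_uniformly_continuous[OF contK]) (auto intro: compact_Times)
  have "uniform_limit (cball x d) ?F (\<lambda>z. integral {0..1} (f z)) sequentially"
  proof (rule uniform_limitI)
    fix e :: real assume e: "e > 0"
    then obtain \<delta> where \<delta>: "\<delta> > 0" "\<And>p q. p \<in> cball x d \<times> {0..1} \<Longrightarrow> q \<in> cball x d \<times> {0..1} \<Longrightarrow>
        dist q p < \<delta> \<Longrightarrow> dist ((\<lambda>(z, t). f z t) q) ((\<lambda>(z, t). f z t) p) < e / 2"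
      using uc unfolding uniformly_continuous_on_def by (metis half_gt_zero)
    have "\<forall>\<^sub>F n in sequentially. 1 / real n < \<delta> / 2"
      using \<delta>(1) by (intro order_tendstoD[OF lim_1_over_n]) auto
    then show "\<forall>\<^sub>F n in sequentially. \<forall>z\<in>cball x d. dist (?F n z) (integral {0..1} (f z)) < e"
      using eventually_gt_at_top[of "0::nat"]
    proof eventually_elim
      case (elim n)
      show ?case
      proof
        fix z assume z: "z \<in> cball x d"
        have "continuous_on {0..1} (\<lambda>t. (\<lambda>(z, t). f z t) (z, t))"
          by (rule continuous_on_compose2[OF contK]) (use z in \<open>auto intro!: continuous_intros\<close>)
        then have "continuous_on {0..1} (f z)" by simp
        then have "norm (integral {0..1} (f z) - (\<Sum>k<n. (1 / real n) *\<^sub>R f z ((real k + 0) / real n))) \<le> e / 2"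
        proof (rule riemann_sum_dist)
          fix s t :: real assume st: "s \<in> {0..1}" "t \<in> {0..1}" "\<bar>s - t\<bar> \<le> \<delta> / 2"
          then have "dist (z, s) (z, t) < \<delta>" using \<delta>(1) by (simp add: dist_Pair_Pair dist_real_def)
          from \<delta>(2)[OF _ _ this] st z show "norm (f z s - f z t) \<le> e / 2" by (simp add: dist_norm)
        qed (use elim in auto)
        then show "dist (?F n z) (integral {0..1} (f z)) < e"
          using e by (simp add: dist_norm norm_minus_commute)
      qed
    qed
  qed
  then show "\<exists>d>0. cball x d \<subseteq> S \<and> uniform_limit (cball x d) ?F (\<lambda>z. integral {0..1} (f z)) sequentially"
    using d by blast
qed

section \<open>Riesz projections of an analytic family\<close>

lemma coord_lin_comb:
  assumes "basis_list bs V" "i < length bs"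
  shows "coord bs (\<Sum>j<length bs. c j *\<^sub>C bs ! j) i = c i"
proof -
  have "coord bs (\<Sum>j<length bs. c j *\<^sub>C bs ! j) i = (\<Sum>j<length bs. c j * coord bs (bs ! j) i)"
    by (rule coord_sum[OF assms(1)]) (auto intro: basis_list_nth_in[OF assms(1)])
  also have "\<dots> = (\<Sum>j<length bs. if i = j then c j else 0)"
    by (intro sum.cong refl) (simp add: coord_nth[OF assms])
  also have "\<dots> = c i" using assms(2) by simp
  finally show ?thesis .
qed

lemma sum_append_split:
  fixes w :: "nat \<Rightarrow> 'h::complex_hilbert"
  shows "(\<Sum>j<length (ks @ cs). w j) = (\<Sum>j<length ks. w j) + (\<Sum>j=length ks..<length (ks @ cs). w j)"
  using sum.atLeastLessThan_concat[of 0 "length ks" "length (ks @ cs)" w] by (simp add: atLeast0LessThan)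

lemma bounded_ops_sum:
  assumes "T \<in> bounded_ops"
  shows "blinfun_apply T (\<Sum>j\<in>J. c j *\<^sub>C v j) = (\<Sum>j\<in>J. c j *\<^sub>C blinfun_apply T (v j))"
  by (simp add: blinfun.sum_right bounded_ops_scaleC[OF assms])

section \<open>The determinant left after dividing the kernel columns\<close>

text \<open>A relation among the columns reads P D u + A v = 0, with \<open>u\<close> in the kernel
  and \<open>v\<close> in the span of \<open>cs\<close>. Since A is injective on that span, the
  relation is trivial as soon as u = 0; modulo ran A, the relation says that D u vanishes, because I
  - P = A S.\<close>

lemma det_block_derivative_eq_0_iff:
  fixes A D P S :: "'h::complex_hilbert \<Rightarrow>\<^sub>L 'h"
  assumes ops: "A \<in> bounded_ops" "D \<in> bounded_ops" "P \<in> bounded_ops"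
    and PA: "\<And>x. blinfun_apply P (blinfun_apply A x) = blinfun_apply A (blinfun_apply P x)"
    and idem: "\<And>x. blinfun_apply P (blinfun_apply P x) = blinfun_apply P x"
    and AS: "\<And>x. blinfun_apply A (blinfun_apply S x) = x - blinfun_apply P x"
    and ks: "basis_list ks (op_ker A)" and bs: "basis_list (ks @ cs) (op_ran P)"
  shows "Determinant.det (Matrix.mat (length (ks @ cs)) (length (ks @ cs)) (\<lambda>(i, j).
      coord (ks @ cs) (if j < length ks then blinfun_apply P (blinfun_apply D ((ks @ cs) ! j))
        else blinfun_apply A ((ks @ cs) ! j)) i)) = 0 \<longleftrightarrow>
    \<not> (\<forall>u x. blinfun_apply A u = 0 \<longrightarrow> blinfun_apply D u = blinfun_apply A x \<longrightarrow> u = 0)"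
proof -
  define bs where "bs = ks @ cs"
  define m where "m = length ks"
  define n where "n = length bs"
  define w where "w j = (if j < m then blinfun_apply P (blinfun_apply D (bs ! j)) else blinfun_apply A (bs ! j))" for j
  note bs' = bs[folded bs_def]
  have mn: "m \<le> n" by (simp add: m_def n_def bs_def)
  have split: "(\<Sum>j<n. f j) = (\<Sum>j<m. f j) + (\<Sum>j=m..<n. f j)" for f :: "nat \<Rightarrow> 'h"
    using sum_append_split[of f ks cs] by (simp add: m_def n_def bs_def)
  have PV: "blinfun_apply P v = v" if "v \<in> op_ran P" for v
    using that idem by (auto simp: op_ran_def)
  have ker: "blinfun_apply A (bs ! j) = 0" if "j < m" for j
    using basis_list_nth_in[OF ks, of j] that by (simp add: op_ker_def bs_def m_def nth_append)
  have wV: "w j \<in> op_ran P" if "j < n" for j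
  proof -
    have "bs ! j \<in> op_ran P" using basis_list_nth_in[OF bs'] that by (simp add: n_def)
    then have "blinfun_apply A (bs ! j) = blinfun_apply P (blinfun_apply A (bs ! j))"
      by (simp add: PA PV)
    then show ?thesis by (auto simp: w_def op_ran_def)
  qed
  have w_sum: "(\<Sum>j<n. c j *\<^sub>C w j) = blinfun_apply P (blinfun_apply D (\<Sum>j<m. c j *\<^sub>C bs ! j))
      + blinfun_apply A (\<Sum>j=m..<n. c j *\<^sub>C bs ! j)" for c
    unfolding split by (simp add: w_def bounded_ops_sum ops)
  have ker_sum: "blinfun_apply A (\<Sum>j<m. c j *\<^sub>C bs ! j) = 0" for c
    by (simp add: bounded_ops_sum ops ker)
  have ind: "c j = 0" if "(\<Sum>j<n. c j *\<^sub>C bs ! j) = 0" "j < n" for c j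
    using coord_lin_comb[OF bs', of j c] that by (simp add: n_def complex_vector.representation_zero)
  have ker_rep: "\<exists>d. v = (\<Sum>j<m. d j *\<^sub>C bs ! j)" if "blinfun_apply A v = 0" for v
  proof (rule exI[of _ "coord ks v"])
    have "v = (\<Sum>j<m. coord ks v j *\<^sub>C ks ! j)"
      using basis_list_coord_sum[OF ks, of v] that by (simp add: op_ker_def m_def)
    also have "\<dots> = (\<Sum>j<m. coord ks v j *\<^sub>C bs ! j)"
      by (intro sum.cong) (auto simp: m_def bs_def nth_append)
    finally show "v = \<dots>" .
  qed
  have "Determinant.det (Matrix.mat n n (\<lambda>(i, j). coord bs (w j) i)) = 0 \<longleftrightarrow>
      (\<exists>c. (\<exists>j<n. c j \<noteq> 0) \<and> (\<Sum>j<n. c j *\<^sub>C w j) = 0)"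
    unfolding n_def by (rule det_columns_eq_0_iff[OF bs']) (use wV n_def in simp)
  also have "\<dots> \<longleftrightarrow> \<not> (\<forall>u x. blinfun_apply A u = 0 \<longrightarrow> blinfun_apply D u = blinfun_apply A x \<longrightarrow> u = 0)"
  proof
    assume "\<exists>c. (\<exists>j<n. c j \<noteq> 0) \<and> (\<Sum>j<n. c j *\<^sub>C w j) = 0"
    then obtain c where c: "\<exists>j<n. c j \<noteq> 0" "(\<Sum>j<n. c j *\<^sub>C w j) = 0" by blast
    define u v where "u = (\<Sum>j<m. c j *\<^sub>C bs ! j)" and "v = (\<Sum>j=m..<n. c j *\<^sub>C bs ! j)"
    have uv: "blinfun_apply P (blinfun_apply D u) + blinfun_apply A v = 0"
      using c(2) unfolding w_sum u_def v_def .
    have "u \<noteq> 0"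
    proof
      assume u0: "u = 0"
      then have "blinfun_apply A v = 0" using uv by simp
      then obtain d where d: "v = (\<Sum>j<m. d j *\<^sub>C bs ! j)" using ker_rep by blast
      \<comment> \<open>The vector \<open>v\<close> is a combination of kernel vectors and also of
        the remaining basis vectors; the difference is a relation in the basis, hence
        trivial.\<close>
      have "(\<Sum>j<n. (if j < m then - d j else c j) *\<^sub>C bs ! j) = - v + v"
        unfolding split by (subst d, simp add: v_def sum_negf)
      then have "(if j < m then - d j else c j) = 0" if "j < n" for j
        using ind[of "\<lambda>j. if j < m then - d j else c j" j] that by simp
      then have "c j = 0" if "m \<le> j" "j < n" for j using that by (metis not_le)
      then have v0: "v = 0" by (simp add: v_def)
      have "(\<Sum>j<n. c j *\<^sub>C bs ! j) = 0"
        unfolding split using u0 v0 by (simp add: u_def v_def)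
      then show False using ind c(1) by blast
    qed
    moreover have "blinfun_apply A u = 0" unfolding u_def by (rule ker_sum)
    moreover have "blinfun_apply D u = blinfun_apply A (blinfun_apply S (blinfun_apply D u) - v)"
      using uv by (simp add: blinfun.diff_right AS algebra_simps)
    ultimately show "\<not> (\<forall>u x. blinfun_apply A u = 0 \<longrightarrow> blinfun_apply D u = blinfun_apply A x \<longrightarrow> u = 0)"
      by blast
  next
    assume "\<not> (\<forall>u x. blinfun_apply A u = 0 \<longrightarrow> blinfun_apply D u = blinfun_apply A x \<longrightarrow> u = 0)"
    then obtain u x where u: "blinfun_apply A u = 0" "u \<noteq> 0" and x: "blinfun_apply D u = blinfun_apply A x"
      by blast
    obtain d where d: "u = (\<Sum>j<m. d j *\<^sub>C bs ! j)" using ker_rep[OF u(1)] by blast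
    define p where "p = blinfun_apply P x"
    have p: "p = (\<Sum>j<m. coord bs p j *\<^sub>C bs ! j) + (\<Sum>j=m..<n. coord bs p j *\<^sub>C bs ! j)"
      using basis_list_coord_sum[OF bs', of p] unfolding n_def[symmetric] split
      by (simp add: p_def op_ran_def)
    \<comment> \<open>P D u = P A x = A P x, and \<open>A\<close> sees only the non-kernel
      coordinates of P x; subtracting these from the combination for \<open>u\<close> gives the
      relation.\<close>
    define c where "c j = (if j < m then d j else - coord bs p j)" for j
    have u': "(\<Sum>j<m. c j *\<^sub>C bs ! j) = u" by (simp add: c_def d)
    have "(\<Sum>j=m..<n. c j *\<^sub>C bs ! j) = - (\<Sum>j=m..<n. coord bs p j *\<^sub>C bs ! j)"
      by (simp add: c_def sum_negf)
    moreover have "blinfun_apply A p = blinfun_apply A (\<Sum>j=m..<n. coord bs p j *\<^sub>C bs ! j)"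
      by (subst p) (simp add: blinfun.add_right ker_sum)
    ultimately have "(\<Sum>j<n. c j *\<^sub>C w j) = blinfun_apply P (blinfun_apply D u) - blinfun_apply A p"
      unfolding w_sum u' by (simp add: blinfun.minus_right)
    also have "\<dots> = 0" by (simp add: x PA p_def)
    finally have "(\<Sum>j<n. c j *\<^sub>C w j) = 0" .
    moreover have "\<exists>j<n. c j \<noteq> 0"
    proof (rule ccontr)
      assume "\<not> (\<exists>j<n. c j \<noteq> 0)"
      then have "u = 0" using mn by (simp flip: u')
      with u show False by blast
    qed
    ultimately show "\<exists>c. (\<exists>j<n. c j \<noteq> 0) \<and> (\<Sum>j<n. c j *\<^sub>C w j) = 0" by blast
  qed
  finally show ?thesis unfolding w_def n_def m_def bs_def .
qed

locale riesz_family =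
  fixes A :: "complex \<Rightarrow> 'h::complex_hilbert \<Rightarrow>\<^sub>L 'h" and \<Omega> N :: "complex set"
    and z0 :: complex and \<epsilon> :: real
  assumes analytic: "op_analytic_on A \<Omega>"
    and ops: "\<And>z. z \<in> \<Omega> \<Longrightarrow> A z \<in> bounded_ops"
    and admissible: "riesz_admissible \<Omega> A z0 \<epsilon> N"
begin

abbreviation P :: "complex \<Rightarrow> 'h \<Rightarrow>\<^sub>L 'h" where "P z \<equiv> riesz_proj \<epsilon> (A z)"
abbreviation T :: "complex \<Rightarrow> 'h \<Rightarrow>\<^sub>L 'h" where "T \<equiv> transfer_op A z0 \<epsilon>"
abbreviation V :: "'h set" where "V \<equiv> op_ran (P z0)"

lemma N: "open N" "z0 \<in> N" "N \<subseteq> \<Omega>"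
  using admissible by (auto simp: riesz_admissible_def)

lemma resolvent_circle: "z \<in> N \<Longrightarrow> resolvent_circle (A z) \<epsilon>"
  using admissible ops N by unfold_locales (auto simp: riesz_admissible_def)

lemmas P_idem = resolvent_circle.riesz_proj_idem[OF resolvent_circle]
  and P_commute = resolvent_circle.riesz_proj_commute[OF resolvent_circle]
  and P_ops = resolvent_circle.riesz_proj_bounded_ops[OF resolvent_circle]

lemma derivative_exists:
  assumes "z \<in> N"
  obtains D where "((\<lambda>w. scalar_op (inverse (w - z)) o\<^sub>L (A w - A z)) \<longlongrightarrow> D) (at z)"
  using assms analytic N unfolding op_analytic_on_def by blast

lemma continuous_on_A: "continuous_on N A"
  unfolding continuous_on_def
proof
  fix z assume "z \<in> N"
  then obtain D where "((\<lambda>w. scalar_op (inverse (w - z)) o\<^sub>L (A w - A z)) \<longlongrightarrow> D) (at z)"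
    by (rule derivative_exists)
  then have "(A \<longlongrightarrow> A z) (at z)" by (rule op_analytic_on_tendsto)
  then show "(A \<longlongrightarrow> A z) (at z within N)" by (rule tendsto_within_subset) simp
qed

text \<open>Joint continuity gives both the norm continuity of \<open>P\<close> and the holomorphy
  of integrals depending on \<open>z\<close>.\<close>

lemma continuous_on_resolvent_family:
  "continuous_on (N \<times> {0..1}) (\<lambda>(z, t). circle_resolvent \<epsilon> (A z) t)"
proof -
  have A: "continuous_on (N \<times> {0..1}) (\<lambda>p. A (fst p))"
    by (rule continuous_on_compose2[OF continuous_on_A]) (auto intro: continuous_intros)
  have circ: "continuous_on (N \<times> {0..1}) (\<lambda>p. circlepath 0 \<epsilon> (snd p))"
    by (rule continuous_on_compose2[OF continuous_on_circlepath[of UNIV]]) (auto intro: continuous_intros)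
  have "continuous_on (N \<times> {0..1}) (\<lambda>p. A (fst p) - scalar_op (circlepath 0 \<epsilon> (snd p)))"
    by (intro continuous_intros A continuous_on_scalar_op circ)
  moreover have "\<forall>\<^sub>F p in at q within N \<times> {0..1}.
      boundedly_invertible (A (fst p) - scalar_op (circlepath 0 \<epsilon> (snd p)))" for q
    unfolding eventually_at_filter
    by (rule always_eventually) (auto intro: resolvent_circle.invertible[OF resolvent_circle])
  ultimately have "continuous_on (N \<times> {0..1}) (\<lambda>p. op_inv (A (fst p) - scalar_op (circlepath 0 \<epsilon> (snd p))))"
    unfolding continuous_on_def
    by (auto intro!: tendsto_op_inv resolvent_circle.invertible[OF resolvent_circle])
  then show ?thesis
    unfolding circle_resolvent_def case_prod_unfold
    by (intro continuous_on_blinfun_compose continuous_on_scalar_op continuous_on_minus circ)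
qed

lemma P_tendsto: "(P \<longlongrightarrow> P z0) (at z0)"
proof -
  have "continuous_on N (\<lambda>z. integral {0..1} (circle_resolvent \<epsilon> (A z)))"
    using integral_continuous_on_param[of N "0::real" 1 "\<lambda>z. circle_resolvent \<epsilon> (A z)"]
      continuous_on_resolvent_family by simp
  then have "continuous_on N P"
    by (simp add: resolvent_circle.riesz_proj_eq_integral[OF resolvent_circle] cong: continuous_on_cong)
  then show ?thesis
    using N by (simp add: continuous_on_eq_continuous_at isCont_def)
qed

section \<open>Holomorphy of matrix entries, through complex-linear functionals\<close>

context
  fixes \<phi> :: "'h \<Rightarrow> complex"
  assumes \<phi>: "bounded_linear \<phi>" and \<phi>_scale: "\<And>c x. \<phi> (c *\<^sub>C x) = c * \<phi> x"
begin

interpretation \<phi>: bounded_linear \<phi> by (rule \<phi>)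

text \<open>The difference quotient of the resolvent R is - R(w) q(w) R(z), with q that of A; it
  tends to - R(z) D R(z).\<close>

lemma holomorphic_resolvent:
  assumes inv: "\<And>z. z \<in> N \<Longrightarrow> boundedly_invertible (A z - scalar_op \<zeta>)"
  shows "(\<lambda>z. \<phi> (blinfun_apply (op_inv (A z - scalar_op \<zeta>)) x)) holomorphic_on N"
  unfolding holomorphic_on_open[OF N(1)]
proof (intro ballI)
  fix z assume z: "z \<in> N"
  let ?R = "\<lambda>z. op_inv (A z - scalar_op \<zeta>)"
  obtain D where D: "((\<lambda>w. scalar_op (inverse (w - z)) o\<^sub>L (A w - A z)) \<longlongrightarrow> D) (at z)"
    using z by (rule derivative_exists)
  have N_at: "\<forall>\<^sub>F w in at z. w \<in> N" using N(1) z by (rule eventually_at_in_open')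
  have inv_at: "\<forall>\<^sub>F w in at z. boundedly_invertible (A w - scalar_op \<zeta>)"
    using N_at by eventually_elim (rule inv)
  have R: "(?R \<longlongrightarrow> ?R z) (at z)"
    by (rule tendsto_op_inv[OF tendsto_diff[OF op_analytic_on_tendsto[OF D] tendsto_const] inv[OF z] inv_at])
  have "((\<lambda>w. \<phi> (- blinfun_apply (?R w) (blinfun_apply (scalar_op (inverse (w - z)) o\<^sub>L (A w - A z)) (blinfun_apply (?R z) x))))
      \<longlongrightarrow> \<phi> (- blinfun_apply (?R z) (blinfun_apply D (blinfun_apply (?R z) x)))) (at z)"
    by (intro \<phi>.tendsto tendsto_minus blinfun.tendsto R D tendsto_const)
  moreover have "\<forall>\<^sub>F w in at z.
      \<phi> (- blinfun_apply (?R w) (blinfun_apply (scalar_op (inverse (w - z)) o\<^sub>L (A w - A z)) (blinfun_apply (?R z) x)))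
      = (\<phi> (blinfun_apply (?R w) x) - \<phi> (blinfun_apply (?R z) x)) / (w - z)"
    using N_at
  proof eventually_elim
    case (elim w)
    define r where "r = blinfun_apply (?R z) x"
    have "x = blinfun_apply (A z - scalar_op \<zeta>) r"
      by (simp add: r_def op_inv_right_apply[OF inv[OF z]])
    then have "blinfun_apply (?R w) x - r
        = blinfun_apply (?R w) (blinfun_apply (A z - scalar_op \<zeta>) r - blinfun_apply (A w - scalar_op \<zeta>) r)"
      by (simp add: blinfun.diff_right op_inv_left_apply[OF inv[OF elim]])
    also have "\<dots> = - blinfun_apply (?R w) (blinfun_apply (A w - A z) r)"
      by (simp add: blinfun.diff_left flip: blinfun.minus_right)
    finally have "\<phi> (blinfun_apply (?R w) x) - \<phi> r = - \<phi> (blinfun_apply (?R w) (blinfun_apply (A w - A z) r))"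
      by (simp add: \<phi>.neg flip: \<phi>.diff)
    then show ?case
      by (simp add: r_def[symmetric] bounded_ops_scaleC[OF op_inv_bounded_ops[OF inv[OF elim]]]
          \<phi>.neg \<phi>_scale divide_inverse mult.commute)
  qed
  ultimately show "\<exists>f'. ((\<lambda>z. \<phi> (blinfun_apply (?R z) x)) has_field_derivative f') (at z)"
    unfolding has_field_derivative_iff by (intro exI) (rule Lim_transform_eventually)
qed

lemma P_functional_eq_integral:
  assumes "z \<in> N"
  shows "\<phi> (blinfun_apply (P z) v) = integral {0..1} (\<lambda>t. \<phi> (blinfun_apply (circle_resolvent \<epsilon> (A z) t) v))"
  using integral_linear[OF resolvent_circle.integrable_circle_resolvent[OF resolvent_circle[OF assms]]
      bounded_linear_compose[OF \<phi> blinfun.bounded_linear_left[of v]]]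
  by (simp add: resolvent_circle.riesz_proj_eq_integral[OF resolvent_circle[OF assms]] o_def)

lemma sphere_invertible:
  "z \<in> N \<Longrightarrow> boundedly_invertible (A z - scalar_op (circlepath 0 \<epsilon> t))"
  by (rule resolvent_circle.invertible[OF resolvent_circle])

lemma holomorphic_P: "(\<lambda>z. \<phi> (blinfun_apply (P z) v)) holomorphic_on N"
proof -
  have "(\<lambda>z. integral {0..1} (\<lambda>t. \<phi> (blinfun_apply (circle_resolvent \<epsilon> (A z) t) v))) holomorphic_on N"
  proof (rule holomorphic_on_integral[OF N(1)])
    show "continuous_on (N \<times> {0..1}) (\<lambda>(z, t). \<phi> (blinfun_apply (circle_resolvent \<epsilon> (A z) t) v))"
      using continuous_on_resolvent_family unfolding case_prod_unfold
      by (intro \<phi>.continuous_on blinfun.continuous_on continuous_on_const)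
    show "(\<lambda>z. \<phi> (blinfun_apply (circle_resolvent \<epsilon> (A z) t) v)) holomorphic_on N" for t
      unfolding circle_resolvent_def
      by (simp add: \<phi>_scale \<phi>.neg) (intro holomorphic_intros holomorphic_resolvent sphere_invertible)
  qed
  then show ?thesis by (simp add: P_functional_eq_integral cong: holomorphic_cong)
qed

text \<open>Here the argument of P(z) moves with \<open>z\<close>. The identity R A v = v + \<zeta>
  R v, for R = (A z - \<zeta>)^-1, reduces the integrand to resolvents applied to the fixed vector
  \<open>v\<close>.\<close>

lemma holomorphic_PA: "(\<lambda>z. \<phi> (blinfun_apply (P z) (blinfun_apply (A z) v))) holomorphic_on N"
proof -
  have "(\<lambda>z. integral {0..1} (\<lambda>t. \<phi> (blinfun_apply (circle_resolvent \<epsilon> (A z) t) (blinfun_apply (A z) v))))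
      holomorphic_on N"
  proof (rule holomorphic_on_integral[OF N(1)])
    have "continuous_on (N \<times> {0..1::real}) (\<lambda>p. A (fst p))"
      by (rule continuous_on_compose2[OF continuous_on_A]) (auto intro: continuous_intros)
    then show "continuous_on (N \<times> {0..1})
        (\<lambda>(z, t). \<phi> (blinfun_apply (circle_resolvent \<epsilon> (A z) t) (blinfun_apply (A z) v)))"
      using continuous_on_resolvent_family unfolding case_prod_unfold
      by (intro \<phi>.continuous_on blinfun.continuous_on continuous_on_const)
    fix t :: real
    let ?\<zeta> = "circlepath 0 \<epsilon> t"
    have "(\<lambda>z. - ?\<zeta> * (\<phi> v + ?\<zeta> * \<phi> (blinfun_apply (op_inv (A z - scalar_op ?\<zeta>)) v))) holomorphic_on N"
      by (intro holomorphic_intros holomorphic_resolvent sphere_invertible)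
    moreover have "\<phi> (blinfun_apply (circle_resolvent \<epsilon> (A z) t) (blinfun_apply (A z) v))
        = - ?\<zeta> * (\<phi> v + ?\<zeta> * \<phi> (blinfun_apply (op_inv (A z - scalar_op ?\<zeta>)) v))" if z: "z \<in> N" for z
    proof -
      have "blinfun_apply (A z) v = blinfun_apply (A z - scalar_op ?\<zeta>) v + ?\<zeta> *\<^sub>C v"
        by (simp add: blinfun.diff_left)
      then have "blinfun_apply (op_inv (A z - scalar_op ?\<zeta>)) (blinfun_apply (A z) v)
          = v + ?\<zeta> *\<^sub>C blinfun_apply (op_inv (A z - scalar_op ?\<zeta>)) v"
        by (simp only: blinfun.add_right op_inv_left_apply[OF sphere_invertible[OF z]]
            bounded_ops_scaleC[OF op_inv_bounded_ops[OF sphere_invertible[OF z]]])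
      then show ?thesis
        by (simp add: circle_resolvent_def \<phi>_scale \<phi>.add \<phi>.neg)
    qed
    ultimately show "(\<lambda>z. \<phi> (blinfun_apply (circle_resolvent \<epsilon> (A z) t) (blinfun_apply (A z) v))) holomorphic_on N"
      by (simp cong: holomorphic_cong)
  qed
  then show ?thesis by (simp add: P_functional_eq_integral cong: holomorphic_cong)
qed

text \<open>Because A(z0) v = 0, the difference quotient is P(w) q(w) v with q that of A; the
  derivative of P does not enter, only its continuity.\<close>

lemma deriv_PA_kernel:
  assumes D: "((\<lambda>w. scalar_op (inverse (w - z0)) o\<^sub>L (A w - A z0)) \<longlongrightarrow> D) (at z0)"
    and v: "blinfun_apply (A z0) v = 0"
  shows "deriv (\<lambda>z. \<phi> (blinfun_apply (P z) (blinfun_apply (A z) v))) z0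
    = \<phi> (blinfun_apply (P z0) (blinfun_apply D v))"
proof (rule DERIV_imp_deriv)
  have "((\<lambda>w. \<phi> (blinfun_apply (P w) (blinfun_apply (scalar_op (inverse (w - z0)) o\<^sub>L (A w - A z0)) v)))
      \<longlongrightarrow> \<phi> (blinfun_apply (P z0) (blinfun_apply D v))) (at z0)"
    by (intro \<phi>.tendsto blinfun.tendsto D P_tendsto tendsto_const)
  moreover have "\<forall>\<^sub>F w in at z0. w \<in> N" using N(1,2) by (rule eventually_at_in_open')
  then have "\<forall>\<^sub>F w in at z0.
      \<phi> (blinfun_apply (P w) (blinfun_apply (scalar_op (inverse (w - z0)) o\<^sub>L (A w - A z0)) v))
      = (\<phi> (blinfun_apply (P w) (blinfun_apply (A w) v)) - \<phi> (blinfun_apply (P z0) (blinfun_apply (A z0) v))) / (w - z0)"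
    by eventually_elim (simp add: v blinfun.diff_left bounded_ops_scaleC[OF P_ops] \<phi>_scale \<phi>.zero divide_inverse mult.commute)
  ultimately show "((\<lambda>z. \<phi> (blinfun_apply (P z) (blinfun_apply (A z) v))) has_field_derivative
      \<phi> (blinfun_apply (P z0) (blinfun_apply D v))) (at z0)"
    unfolding has_field_derivative_iff by (rule Lim_transform_eventually)
qed

end

section \<open>The block on ran P(z0)\<close>

lemma V_fixed: "v \<in> V \<Longrightarrow> blinfun_apply (P z0) v = v"
  using P_idem[OF N(2)] by (auto simp: op_ran_def)

lemma in_V: "blinfun_apply (P z0) v \<in> V"
  by (simp add: op_ran_def)

lemma T_invertible: "z \<in> N \<Longrightarrow> boundedly_invertible (T z)"
  using admissible by (simp add: riesz_admissible_def)

lemma T_ops: "z \<in> N \<Longrightarrow> T z \<in> bounded_ops"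
  unfolding transfer_op_def using N(2)
  by (intro bounded_ops_add bounded_ops_compose bounded_ops_diff bounded_ops_id P_ops)

text \<open>The second summand of \<open>T z\<close> drops out by Q(z) P(z) = 0.\<close>

lemma T_P:
  assumes "z \<in> N"
  shows "blinfun_apply (T z) (blinfun_apply (P z) x) = blinfun_apply (P z0) (blinfun_apply (P z) x)"
  by (simp add: transfer_op_def blinfun.add_left blinfun.diff_left P_idem[OF assms])

text \<open>The second summand of \<open>T z\<close> drops out by P(z0) Q(z0) = 0.\<close>

lemma P_T:
  assumes "z \<in> N"
  shows "blinfun_apply (P z0) (blinfun_apply (T z) x) = blinfun_apply (P z0) (blinfun_apply (P z) x)"
  by (simp add: transfer_op_def blinfun.add_left blinfun.diff_left blinfun.add_right blinfun.diff_right
      P_idem[OF N(2)])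

text \<open>An operator on the whole space; F(z) is its restriction to \<open>V\<close>.\<close>

definition block :: "complex \<Rightarrow> 'h \<Rightarrow>\<^sub>L 'h" where
  "block z = T z o\<^sub>L A z o\<^sub>L op_inv (T z)"

lemma block_ops: "z \<in> N \<Longrightarrow> block z \<in> bounded_ops"
  unfolding block_def using N(3)
  by (intro bounded_ops_compose T_ops op_inv_bounded_ops T_invertible ops) auto

text \<open>On ran P(z) the map P(z0) is T(z), so T(z)^-1 cancels. F(z) is thereby tied to functions
  whose holomorphy is known without studying T(z)^-1.\<close>

lemma block_intertwine:
  assumes "z \<in> N"
  shows "blinfun_apply (block z) (blinfun_apply (P z0) (blinfun_apply (P z) v))
    = blinfun_apply (P z0) (blinfun_apply (P z) (blinfun_apply (A z) v))"
proof -
  have "blinfun_apply (block z) (blinfun_apply (P z0) (blinfun_apply (P z) v))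
      = blinfun_apply (T z) (blinfun_apply (A z) (blinfun_apply (P z) v))"
    by (simp only: block_def T_P[OF assms, symmetric] blinfun_apply_blinfun_compose
        op_inv_left_apply[OF T_invertible[OF assms]])
  then show ?thesis by (simp only: P_commute[OF assms, symmetric] T_P[OF assms])
qed

text \<open>Every \<open>v\<close> in \<open>V\<close> is P(z0) P(z) w for w = T(z)^-1 v, so
  \<open>block_intertwine\<close> describes the block on all of \<open>V\<close>.\<close>

lemma block_invariant:
  assumes z: "z \<in> N" and v: "v \<in> V"
  shows "blinfun_apply (block z) v \<in> V"
proof -
  define w where "w = blinfun_apply (op_inv (T z)) v"
  have Tw: "blinfun_apply (T z) w = v" by (simp add: w_def op_inv_right_apply[OF T_invertible[OF z]])
  have "v = blinfun_apply (P z0) (blinfun_apply (P z) w)"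
    using P_T[OF z, of w] V_fixed[OF v] by (simp add: Tw)
  then show ?thesis
    using block_intertwine[OF z, of w] in_V by simp
qed

text \<open>Apply S A = I - P to a kernel vector.\<close>

lemma kernel_subset_V: "op_ker (A z0) \<subseteq> V"
proof
  fix x assume x: "x \<in> op_ker (A z0)"
  obtain S where S: "\<forall>x. blinfun_apply (A z0) (blinfun_apply S x) = x - blinfun_apply (P z0) x \<and>
      blinfun_apply S (blinfun_apply (A z0) x) = x - blinfun_apply (P z0) x"
    using resolvent_circle.riesz_proj_complement_inverse[OF resolvent_circle[OF N(2)]] by (rule exE)
  from S[THEN spec, of x] x have "x = blinfun_apply (P z0) x" by (simp add: op_ker_def)
  then show "x \<in> V" by (rule ssubst) (rule in_V)
qed

lemma subspaces: "complex_vector.subspace (op_ker (A z0))" "complex_vector.subspace V"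
proof -
  have A: "A z0 \<in> bounded_ops" using ops N by blast
  show "complex_vector.subspace (op_ker (A z0))"
    by (rule complex_vector.subspaceI)
      (simp_all add: op_ker_def blinfun.add_right bounded_ops_scaleC[OF A])
  have "v \<in> V \<longleftrightarrow> blinfun_apply (P z0) v = v" for v
    using V_fixed[of v] in_V[of v] by (intro iffI) simp_all
  then show "complex_vector.subspace V"
    by (intro complex_vector.subspaceI)
      (simp_all only: blinfun.add_right bounded_ops_scaleC[OF P_ops[OF N(2)]] blinfun.zero_right)
qed

section \<open>The order of the zero of the block determinant\<close>

text \<open>Rests on \<open>block_det\<close> times \<open>detQ\<close> being (z - z0)^m times
  \<open>detH\<close>, where \<open>detQ\<close> is 1 at \<open>z0\<close>. Dividing by
  \<open>detQ\<close> near \<open>z0\<close> gives order at least \<open>m\<close>, with equality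
  iff \<open>detH\<close> is nonzero at \<open>z0\<close>.\<close>

lemma nu_eq_iff:
  assumes D: "((\<lambda>w. scalar_op (inverse (w - z0)) o\<^sub>L (A w - A z0)) \<longlongrightarrow> D) (at z0)"
    and D_ops: "D \<in> bounded_ops"
    and inv: "\<forall>\<^sub>F w in at z0. boundedly_invertible (A w)"
  shows "nu A z0 \<epsilon> N = enat (geom_mult0 (A z0)) \<longleftrightarrow>
    (\<forall>u x. blinfun_apply (A z0) u = 0 \<longrightarrow> blinfun_apply D u = blinfun_apply (A z0) x \<longrightarrow> u = 0)"
proof -
  have A0: "A z0 \<in> bounded_ops" using ops N by blast
  have fin: "cfinite_dim V" using admissible N by (auto simp: riesz_admissible_def)
  obtain ks cs where ks: "basis_list ks (op_ker (A z0))" and bs: "basis_list (ks @ cs) V"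
    by (rule basis_list_extend[OF subspaces(2) fin subspaces(1) kernel_subset_V])
  define bs where "bs = ks @ cs"
  define n where "n = length bs"
  define m where "m = length ks"
  note bs' = bs[folded bs_def]
  have mn: "m \<le> n" by (simp add: m_def n_def bs_def)
  have m: "m = geom_mult0 (A z0)"
    using basis_list_length[OF ks] by (simp add: m_def geom_mult0_def)
  have bsV: "bs ! j \<in> V" if "j < n" for j using basis_list_nth_in[OF bs'] that by (simp add: n_def)
  have ker: "blinfun_apply (A z0) (bs ! j) = 0" if "j < m" for j
    using basis_list_nth_in[OF ks, of j] that by (simp add: op_ker_def bs_def m_def nth_append)
  have "\<exists>y. \<forall>v\<in>V. \<forall>a\<in>set bs. complex_vector.representation (set bs) v a = cinner (y a) v"
    using representation_eq_cinner[of "set bs"] bs' by (simp add: basis_list_def)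
  then obtain y where y: "\<forall>v\<in>V. \<forall>a\<in>set bs.
      complex_vector.representation (set bs) v a = cinner (y a) v" by (rule exE)
  \<comment> \<open>Composition with P(z0) extends the coordinate functionals from \<open>V\<close>
    to bounded functionals on the whole space.\<close>
  define \<phi> where "\<phi> i v = cinner (y (bs ! i)) (blinfun_apply (P z0) v)" for i v
  have \<phi>: "bounded_linear (\<phi> i)" "\<phi> i (c *\<^sub>C x) = c * \<phi> i x" for i c x
    unfolding \<phi>_def
    by (auto intro!: bounded_linear_compose[OF bounded_linear_cinner] blinfun.bounded_linear_right
        simp: bounded_ops_scaleC[OF P_ops[OF N(2)]] cinner_scaleC_right)
  have coord: "coord bs (blinfun_apply (P z0) v) i = \<phi> i v" if "i < n" for i v
    using y[THEN bspec, OF in_V, of v, THEN bspec, of "bs ! i"] that by (simp add: \<phi>_def n_def)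
  define M where "M i j z = \<phi> i (blinfun_apply (P z) (blinfun_apply (A z) (bs ! j)))" for i j z
  define Q where "Q i j z = \<phi> i (blinfun_apply (P z) (bs ! j))" for i j z
  \<comment> \<open>The kernel columns of \<open>M\<close> vanish at \<open>z0\<close>; they are
    divided by z - z0, and the derivative fills the removable singularity.\<close>
  define h where "h i j z = (if j < m then (if z = z0 then deriv (M i j) z0 else (M i j z - M i j z0) / (z - z0))
      else M i j z)" for i j z
  define detQ where "detQ z = Determinant.det (Matrix.mat n n (\<lambda>(i, j). Q i j z))" for z
  define detH where "detH z = Determinant.det (Matrix.mat n n (\<lambda>(i, j). h i j z))" for z
  have M_hol: "M i j holomorphic_on N" for i j
    unfolding M_def by (rule holomorphic_PA[OF \<phi>])
  have Q_hol: "Q i j holomorphic_on N" for i j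
    unfolding Q_def by (rule holomorphic_P[OF \<phi>])
  have h_hol: "h i j holomorphic_on N" for i j
  proof (cases "j < m")
    case True
    then show ?thesis using pole_lemma_open[OF M_hol[of i j] N(1), of z0] by (simp add: h_def[abs_def])
  next
    case False
    then show ?thesis using M_hol[of i j] by (simp add: h_def[abs_def])
  qed
  have detQ_hol: "detQ holomorphic_on N" and detH_hol: "detH holomorphic_on N"
    unfolding detQ_def detH_def by (intro holomorphic_on_det Q_hol h_hol)+
  have M0: "M i j z0 = 0" if "j < m" for i j
    using \<phi>(2)[of i 0 0] by (simp add: M_def ker[OF that])
  have M_h: "M i j z = (if j < m then z - z0 else 1) * h i j z" for i j z
    by (simp add: h_def M0)
  have prod: "(\<Prod>j<n. if j < m then z - z0 else 1) = (z - z0) ^ m" for z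
  proof -
    have "(\<Prod>j<n. if j < m then z - z0 else 1) = (\<Prod>j<m. z - z0)"
      using mn by (intro prod.mono_neutral_cong_right) auto
    then show ?thesis by simp
  qed
  have detM: "Determinant.det (Matrix.mat n n (\<lambda>(i, j). M i j z)) = (z - z0) ^ m * detH z" for z
    unfolding M_h detH_def by (subst det_scale_columns) (simp only: prod)
  have block_det: "block_det A z0 \<epsilon> z = Determinant.det (rep_mat bs bs (blinfun_apply (block z)))"
    if "z \<in> N" for z
    unfolding block_det_def block_def[symmetric]
    using that by (intro det_on_eq_det_rep_mat bounded_ops_linear block_ops block_invariant bs')
  have block_detQ: "block_det A z0 \<epsilon> z * detQ z = (z - z0) ^ m * detH z" if z: "z \<in> N" for z
  proof -
    have "rep_mat bs bs (blinfun_apply (block z)) * rep_mat bs bs (\<lambda>v. blinfun_apply (P z0) (blinfun_apply (P z) v))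
        = rep_mat bs bs (\<lambda>v. blinfun_apply (P z0) (blinfun_apply (P z) (blinfun_apply (A z) v)))"
      using rep_mat_mult[OF bounded_ops_linear[OF block_ops[OF z]] bs' bs' bs' block_invariant[OF z],
          of "\<lambda>v. blinfun_apply (P z0) (blinfun_apply (P z) v)"] in_V
      by (simp add: block_intertwine[OF z])
    moreover have "rep_mat bs bs (\<lambda>v. blinfun_apply (P z0) (blinfun_apply (P z) v))
        = Matrix.mat n n (\<lambda>(i, j). Q i j z)"
      by (rule eq_matI) (simp_all add: rep_mat_def n_def[symmetric] coord Q_def)
    moreover have "rep_mat bs bs (\<lambda>v. blinfun_apply (P z0) (blinfun_apply (P z) (blinfun_apply (A z) v)))
        = Matrix.mat n n (\<lambda>(i, j). M i j z)"
      by (rule eq_matI) (simp_all add: rep_mat_def n_def[symmetric] coord M_def)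
    ultimately have "Determinant.det (rep_mat bs bs (blinfun_apply (block z)) * Matrix.mat n n (\<lambda>(i, j). Q i j z))
        = (z - z0) ^ m * detH z"
      by (simp only: detM)
    moreover have "Determinant.det (rep_mat bs bs (blinfun_apply (block z)) * Matrix.mat n n (\<lambda>(i, j). Q i j z))
        = block_det A z0 \<epsilon> z * detQ z"
      unfolding detQ_def block_det[OF z]
      by (rule Determinant.det_mult) (use rep_mat_carrier[of bs bs] in \<open>auto simp: n_def\<close>)
    ultimately show ?thesis by simp
  qed
  \<comment> \<open>Where A(z) is invertible, the block is injective, so its matrix on
    \<open>V\<close> has no null vector.\<close>
  have block_det_nonzero: "block_det A z0 \<epsilon> z \<noteq> 0" if z: "z \<in> N" "boundedly_invertible (A z)" for z
  proof
    assume "block_det A z0 \<epsilon> z = 0"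
    then have "Determinant.det (Matrix.mat (length bs) (length bs) (\<lambda>(i, j). coord bs (blinfun_apply (block z) (bs ! j)) i)) = 0"
      by (simp add: block_det[OF z(1)] rep_mat_def)
    then obtain c where c: "\<exists>j<length bs. c j \<noteq> 0" "(\<Sum>j<length bs. c j *\<^sub>C blinfun_apply (block z) (bs ! j)) = 0"
      using det_columns_eq_0_iff[OF bs'] block_invariant[OF z(1)] bsV by (auto simp: n_def)
    define v where "v = (\<Sum>j<length bs. c j *\<^sub>C bs ! j)"
    have "blinfun_apply (block z) v = 0"
      using c(2) by (simp add: v_def bounded_ops_sum[OF block_ops[OF z(1)]])
    then have "blinfun_apply (T z) (blinfun_apply (A z) (blinfun_apply (op_inv (T z)) v)) = 0"
      by (simp add: block_def)
    then have "v = 0"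
      using op_inv_left_apply[OF T_invertible[OF z(1)]] op_inv_right_apply[OF T_invertible[OF z(1)]]
        op_inv_left_apply[OF z(2)] by (metis blinfun.zero_right)
    then have "c j = 0" if "j < length bs" for j
      using coord_lin_comb[OF bs' that, of c] by (simp add: v_def complex_vector.representation_zero)
    with c(1) show False by blast
  qed
  have detQ0: "detQ z0 = 1"
  proof -
    have "Matrix.mat n n (\<lambda>(i, j). Q i j z0) = 1\<^sub>m n"
    proof (rule eq_matI)
      fix i j assume "i < dim_row (1\<^sub>m n :: complex Matrix.mat)" "j < dim_col (1\<^sub>m n :: complex Matrix.mat)"
      then have ij: "i < n" "j < n" by simp_all
      then have "Q i j z0 = coord bs (bs ! j) i"
        by (simp add: Q_def V_fixed bsV flip: coord)
      then show "Matrix.mat n n (\<lambda>(i, j). Q i j z0) $$ (i, j) = 1\<^sub>m n $$ (i, j)"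
        using ij coord_nth[OF bs', of i j] by (simp add: n_def)
    qed simp_all
    then show ?thesis by (simp add: detQ_def)
  qed
  have "continuous_on N detQ" using detQ_hol by (rule holomorphic_on_imp_continuous_on)
  then have "(detQ \<longlongrightarrow> detQ z0) (at z0)"
    using N by (simp add: continuous_on_eq_continuous_at isCont_def)
  then have "\<forall>\<^sub>F w in at z0. detQ w \<noteq> 0"
    by (rule tendsto_imp_eventually_ne) (simp add: detQ0)
  moreover have "\<forall>\<^sub>F w in at z0. w \<in> N" using N(1,2) by (rule eventually_at_in_open')
  ultimately have "\<forall>\<^sub>F w in at z0. detQ w \<noteq> 0 \<and> w \<in> N \<and> boundedly_invertible (A w)"
    using inv by eventually_elim simp
  then obtain r where r: "r > 0" and ball: "\<And>w. w \<in> ball z0 r \<Longrightarrow> w \<noteq> z0 \<Longrightarrow>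
      detQ w \<noteq> 0 \<and> w \<in> N \<and> boundedly_invertible (A w)"
    unfolding eventually_at by (auto simp: dist_commute)
  have ballN: "ball z0 r \<subseteq> N" using ball N(2) by blast
  have Q_ne: "detQ w \<noteq> 0" if "w \<in> ball z0 r" for w using ball[OF that] detQ0 by (cases "w = z0") auto
  \<comment> \<open>A point of invertibility in the ball: it excludes the infinite case of
    \<open>nu\<close> and shows that \<open>detH / detQ\<close> does not vanish identically.\<close>
  define w1 where "w1 = z0 + of_real (r/2)"
  have w1: "w1 \<in> ball z0 r" "w1 \<noteq> z0" using r by (auto simp: w1_def dist_norm)
  have w1_ne: "block_det A z0 \<epsilon> w1 \<noteq> 0" using ball[OF w1] by (intro block_det_nonzero) auto
  have quot: "block_det A z0 \<epsilon> w = (w - z0) ^ m * (detH w / detQ w)" if "w \<in> ball z0 r" for w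
    using block_detQ[of w] Q_ne[OF that] ballN that by (auto simp: field_simps)
  have "nat (zorder (block_det A z0 \<epsilon>) z0) = m \<longleftrightarrow> detH z0 / detQ z0 \<noteq> 0"
  proof (rule zorder_power_times_eq_iff)
    show "(\<lambda>w. detH w / detQ w) holomorphic_on ball z0 r"
      using Q_ne by (intro holomorphic_on_divide holomorphic_on_subset[OF detH_hol ballN]
          holomorphic_on_subset[OF detQ_hol ballN]) auto
    show "\<exists>w\<in>ball z0 r. detH w / detQ w \<noteq> 0"
      using w1 w1_ne quot[of w1] by (intro bexI[of _ w1]) auto
  qed (use r quot in auto)
  then have zorder: "nat (zorder (block_det A z0 \<epsilon>) z0) = m \<longleftrightarrow> detH z0 \<noteq> 0"
    by (simp add: detQ0)
  have nu: "nu A z0 \<epsilon> N = enat (geom_mult0 (A z0)) \<longleftrightarrow> detH z0 \<noteq> 0"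
    unfolding nu_def using w1_ne w1(1) ballN zorder m by auto
  obtain S where "\<forall>x. blinfun_apply (A z0) (blinfun_apply S x) = x - blinfun_apply (P z0) x \<and>
      blinfun_apply S (blinfun_apply (A z0) x) = x - blinfun_apply (P z0) x"
    using resolvent_circle.riesz_proj_complement_inverse[OF resolvent_circle[OF N(2)]] by (rule exE)
  then have S: "blinfun_apply (A z0) (blinfun_apply S x) = x - blinfun_apply (P z0) x" for x
    by (rule allE[where x = x]) (rule conjunct1)
  \<comment> \<open>At \<open>z0\<close> the outer projection in \<phi> is absorbed, by idempotence
    or because A(z0) leaves \<open>V\<close> invariant.\<close>
  have h0: "h i j z0 = coord bs (if j < m then blinfun_apply (P z0) (blinfun_apply D (bs ! j))
      else blinfun_apply (A z0) (bs ! j)) i" if ij: "i < n" "j < n" for i j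
  proof (cases "j < m")
    case True
    have "deriv (M i j) z0 = \<phi> i (blinfun_apply (P z0) (blinfun_apply D (bs ! j)))"
      unfolding M_def by (rule deriv_PA_kernel[OF \<phi> D ker[OF True]])
    then show ?thesis
      using True ij by (simp add: h_def P_idem[OF N(2)] flip: coord)
  next
    case False
    have "blinfun_apply (P z0) (blinfun_apply (A z0) (bs ! j)) = blinfun_apply (A z0) (bs ! j)"
      by (simp add: P_commute[OF N(2)] V_fixed[OF bsV[OF ij(2)]])
    then show ?thesis
      using False ij by (simp add: h_def M_def flip: coord)
  qed
  have "detH z0 = Determinant.det (Matrix.mat (length (ks @ cs)) (length (ks @ cs)) (\<lambda>(i, j).
      coord (ks @ cs) (if j < length ks then blinfun_apply (P z0) (blinfun_apply D ((ks @ cs) ! j))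
        else blinfun_apply (A z0) ((ks @ cs) ! j)) i))"
    unfolding detH_def bs_def[symmetric] n_def[symmetric] m_def[symmetric]
    by (rule arg_cong[where f = Determinant.det], rule eq_matI) (simp_all add: h0)
  then have "detH z0 = 0 \<longleftrightarrow>
      \<not> (\<forall>u x. blinfun_apply (A z0) u = 0 \<longrightarrow> blinfun_apply D u = blinfun_apply (A z0) x \<longrightarrow> u = 0)"
    using det_block_derivative_eq_0_iff[OF A0 D_ops P_ops[OF N(2)] P_commute[OF N(2)] P_idem[OF N(2)] S ks bs]
    by simp
  with nu show ?thesis by blast
qed

lemma derivative_bounded_ops:
  assumes D: "((\<lambda>w. scalar_op (inverse (w - z0)) o\<^sub>L (A w - A z0)) \<longlongrightarrow> D) (at z0)"
  shows "D \<in> bounded_ops"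
  unfolding bounded_ops_def
proof (intro CollectI allI)
  fix c x
  let ?q = "\<lambda>w. scalar_op (inverse (w - z0)) o\<^sub>L (A w - A z0)"
  have q: "((\<lambda>w. blinfun_apply (?q w) (c *\<^sub>C x)) \<longlongrightarrow> blinfun_apply D (c *\<^sub>C x)) (at z0)"
    by (intro blinfun.tendsto D tendsto_const)
  have lim: "((\<lambda>w. c *\<^sub>C blinfun_apply (?q w) x) \<longlongrightarrow> c *\<^sub>C blinfun_apply D x) (at z0)"
    by (intro scaleC_tendsto blinfun.tendsto D tendsto_const)
  have "\<forall>\<^sub>F w in at z0. w \<in> N" using N(1,2) by (rule eventually_at_in_open')
  then have ev: "\<forall>\<^sub>F w in at z0. c *\<^sub>C blinfun_apply (?q w) x = blinfun_apply (?q w) (c *\<^sub>C x)"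
  proof eventually_elim
    case (elim w)
    then have "A w - A z0 \<in> bounded_ops" using N by (intro bounded_ops_diff ops) auto
    then have "?q w \<in> bounded_ops" by (intro bounded_ops_compose bounded_ops_scalar)
    then show ?case by (rule bounded_ops_scaleC[symmetric])
  qed
  show "blinfun_apply D (c *\<^sub>C x) = c *\<^sub>C blinfun_apply D x"
    by (rule tendsto_unique[OF at_neq_bot q Lim_transform_eventually[OF lim ev]])
qed

end

theorem corollary3p6:
  fixes A :: "complex \<Rightarrow> 'h::complex_hilbert \<Rightarrow>\<^sub>L 'h"
    and \<Omega> N :: "complex set" and z0 :: complex and \<epsilon>0 :: real
  assumes separable: "separable_space (euclidean :: 'h topology)"
    and Omega: "open \<Omega>" "connected \<Omega>"
    and analytic: "op_analytic_on A \<Omega>"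
    and fredholm: "\<forall>z\<in>\<Omega>. A z \<in> fredholm_ops"
    and z0: "z0 \<in> \<Omega>"
    and pole: "inverse_has_pole A z0"
    and admissible: "riesz_admissible \<Omega> A z0 \<epsilon>0 N"
  shows "inverse_has_simple_pole A z0 \<longleftrightarrow> nu A z0 \<epsilon>0 N = enat (geom_mult0 (A z0))"
proof -
  have ops: "A z \<in> bounded_ops" if "z \<in> \<Omega>" for z
    using fredholm that by (simp add: fredholm_ops_def)
  interpret riesz_family A \<Omega> N z0 \<epsilon>0
    using analytic ops admissible by unfold_locales
  obtain D where D: "((\<lambda>w. scalar_op (inverse (w - z0)) o\<^sub>L (A w - A z0)) \<longlongrightarrow> D) (at z0)"
    using N(2) by (rule derivative_exists)
  have "\<forall>\<^sub>F w in at z0. w \<in> \<Omega>" using Omega(1) z0 by (rule eventually_at_in_open')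
  then have ev: "\<forall>\<^sub>F w in at z0. A w \<in> bounded_ops" by eventually_elim (rule ops)
  obtain n where "inverse_pole_order A z0 n" using pole by (auto simp: inverse_has_pole_def)
  then have inv: "\<forall>\<^sub>F w in at z0. boundedly_invertible (A w)"
    by (rule inverse_pole_order_limits)
  \<comment> \<open>Both sides amount to the same condition: A'(z0) maps no nonzero vector of ker
    A(z0) into ran A(z0).\<close>
  show ?thesis
    unfolding simple_pole_iff[OF ev ops[OF z0] D pole]
      nu_eq_iff[OF D derivative_bounded_ops[OF D] inv] by (rule refl)
qed

end
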